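(* Let the bilevel program (BLPP) without upper level constraints be simple at $(\bar x,\bar y)\in M$. (1) If $S(\bar x)=\{\bar y\}$ and the KKT condition holds at $\bar y$ for $L(\bar x)$, then for any KKT-multiplier $\bar u$, MPCC-LICQ is satisfied at $(\bar x,\bar y,\bar u)$ for program (CP$_\mu$) with $\mu=0$. (2) If $S(\bar x)=\{\bar y\}$ and the KKT condition does not hold at $\bar y$ for $L(\bar x)$, then for any FJ-multiplier $(\bar u_0,\bar u)\in\mathbb{R}\times\mathbb{R}^p$ at $\bar y$ for $L(\bar x)$, where $\bar u_0=0$, MPCC-LICQ is satisfied at $(\bar x,\bar y,\bar u_0,\bar u)$ for program (CPFJ$_\mu$) with $\mu=0$. (3) If $S(\bar x)=\{\bar y_1,\bar y_2\}$, where $\bar y_1=\bar y$, then for the unique KKT-multiplier $\bar u$ of $\bar y$ for $L(\bar x)$, MPCC-LICQ is satisfied at $(\bar x,\bar y,\bar u)$ for program (CP$_\mu$).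
   Context: Setting: $x\in\mathbb{R}$ (dimension $n=1$), $y\in\mathbb{R}^m$; $F:\mathbb{R}^{1+m}\to\mathbb{R}$ is continuously differentiable; $f:\mathbb{R}^{1+m}\to\mathbb{R}$ and $g:\mathbb{R}^{1+m}\to\mathbb{R}^p$ are three times continuously differentiable, and for all $(\hat x,c)\in\mathbb{R}\times\mathbb{R}$ the set $\{(x,y): |x-\hat x|\le1,\ f(x,y)\le c,\ g(x,y)\le0\}$ is compact. $L(x)$: $\min_yf(x,y)$ s.t. $g(x,y)\le0$; $S(x)$ its set of global minimizers; $V(x):=\inf_y\{f(x,y): g(x,y)\le0\}$; $M:=\{(x,y): y\in S(x)\}$. (BLPP): $\min_{x,y}F(x,y)$ s.t. $y\in S(x)$. Put $J_0:=J_0(\bar x,\bar y)=\{j: g_j(\bar x,\bar y)=0\}$. KKT-multipliers at $\bar y$ for $L(\bar x)$: $u\ge0$ with $\nabla_yf+\sum_{i=1}^p u_i\nabla_yg_i=0$, $u^Tg=0$ at $(\bar x,\bar y)$ (the KKT condition holds if one exists). FJ-multipliers: $(u_0,u)\ge0$ with $u_0\nabla_yf+\sum_{i=1}^p u_i\nabla_yg_i=0$, $u^Tg=0$, $\|(u_0,u)\|_1=1$ at $(\bar x,\bar y)$. Types of a point $(\bar x,\bar y)$, where $\bar y$ is feasible for $L(\bar x)$ and there is $(u_0,u)\neq0$ with $u_0\nabla_yf+\sum_{j\in J_0}u_j\nabla_yg_j=0$ at $(\bar x,\bar y)$. LICQ: $\nabla_yg_j(\bar x,\bar y)$, $j\in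 J_0$, are linearly independent (then there are unique $\bar u_j$, $j\in J_0$, with $\nabla_yf+\sum_{j\in J_0}\bar u_j\nabla_yg_j=0$; set $\bar u_j=0$ otherwise). $T:=\{\xi\in\mathbb{R}^m:\nabla_yg_j(\bar x,\bar y)^T\xi=0,\ j\in J_0\}$; for a symmetric matrix $H$ and subspace $W$, "$H$ nonsingular on $W$" means $V^THV$ nonsingular for a matrix $V$ whose columns form a basis of $W$. - Type 1: LICQ; $\bar u_j\ne0$ for $j\in J_0$ (SC); $\nabla^2_{yy}(f+\bar u^Tg)(\bar x,\bar y)$ nonsingular on $T$ (SOC). - Type 2: LICQ; exactly one $\bar u_q$, $q\in J_0$, vanishes; $\nabla^2_{yy}(f+\bar u^Tg)(\bar x,\bar y)$ is nonsingular on $T$ and on $\{\xi:\nabla_yg_j^T\xi=0,\ j\in J_0\setminus\{q\}\}$; and $\frac{d}{dx}g_q(x,\widetilde y(x))|_{x=\bar x}\neq0$, where $(\widetilde y,\widetilde u)$ is the $C^2$ solution near $\bar x$ of $\nabla_yf(x,y)+\sum_{j\in J_0\setminus\{q\}}u_j\nabla_yg_j(x,y)=0$, $g_j(x,y)=0$ ($j\in J_0\setminus\{q\}$), through $(\bar y,\bar u)$. - Type 4: $|J_0|\ge1$; $\{\nabla_yg_j(\bar x,\bar y)\}_{j\in J_0}$ has rank $|J_0|-1<m$; the nonzero solution $\lambda$ (unique up to scaling) of $\sum_{j\in J_0}\lambda_j\nabla_yg_j=0$ has $\lambda_j\neq0$ for all $j\in J_0$; $\sum_{j\in J_0}\lambda_j\nabla_xg_j\neq0$;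 with $V$ a basis matrix of $T$, $A:=V^T\nabla^2_{yy}(\sum_{j\in J_0}\lambda_jg_j)V$ is nonsingular and $b:=V^T\nabla_yf$ satisfies $b^TA^{-1}b\ne0$ (all at $(\bar x,\bar y)$; in particular the KKT condition fails). - Type 5: $|J_0|=m+1$; the full gradients $\nabla g_j(\bar x,\bar y)$, $j\in J_0$, are linearly independent; any $m$ of the vectors $\nabla_yg_j(\bar x,\bar y)$, $j\in J_0$, are linearly independent; for each $i\in J_0$ the unique numbers $u^{(i)}_j$, $j\in J_0\setminus\{i\}$, with $\nabla_yf+\sum_{j\in J_0\setminus\{i\}}u^{(i)}_j\nabla_yg_j=0$ are all nonzero. It is Type 5-1 if MFCQ (existence of $d$ with $\nabla_yg_j^Td<0$ for all $j\in J_0$) fails but the KKT condition holds, and Type 5-2 if MFCQ holds. (BLPP) is simple at $(\bar x,\bar y)\in M$ if either Case I: $S(\bar x)=\{\bar y\}$ and $(\bar x,\bar y)$ is of Type 1, 2, 4, 5-1 or 5-2; or Case II: $S(\bar x)=\{\bar y_1,\bar y_2\}$ (two distinct points), $(\bar x,\bar y_1),(\bar x,\bar y_2)$ are both of Type 1, and $\alpha:=\frac{d}{dx}[f(x,y_2(x))-f(x,y_1(x))]|_{x=\bar x}\neq0$, where $y_k(x)$ is the unique local minimizer of $L(x)$ near $\bar y_k$ for $x$ near $\bar x$, $y_k(\bar x)=\bar y_k$. (CP$_\mu$): $\min_{x,y,u}F(x,y)+\mu(f(x,y)-V(x))$ s.t. $\nabla_yf(x,y)+\sum_iu_i\nabla_yg_i(x,y)=0$,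 $g(x,y)\le0$, $u\ge0$, $u^Tg(x,y)=0$. (CPFJ$_\mu$): $\min_{x,y,u_0,u}F(x,y)+\mu(f(x,y)-V(x))$ s.t. $u_0\nabla_yf(x,y)+\sum_iu_i\nabla_yg_i(x,y)=0$, $g(x,y)\le0$, $(u_0,u)\ge0$, $u^Tg(x,y)=0$, $\|(u_0,u)\|_1=1$ (i.e. $\sum_{i=0}^pu_i=1$). MPCC-LICQ at a feasible point: the gradients, with respect to all variables of the program, of all equality constraint functions other than $u^Tg$ (the $m$ components of the stationarity equation and, for (CPFJ$_\mu$), $\sum_{i=0}^pu_i-1$), of all $g_j$ with $g_j=0$ at the point, and of all coordinate functions $u_k$, $1\le k\le p$, with $u_k=0$ at the point (and, for (CPFJ$_\mu$), also of $u_0$ if $u_0=0$ there), are linearly independent. *)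

theory Defs
  imports "Jordan_Normal_Form.Matrix" "HOL-Analysis.Analysis"
begin

(* The Jordan_Normal_Form matrices are only used for the reduced matrices V^T H V, whose size
   dim W depends on the point; everything else lives in the HOL-Analysis types real^'m. *)
no_notation vec_index (infixl "$" 100)
no_notation scalar_prod (infix "\<bullet>" 70)
no_notation transpose_mat ("(_\<^sup>T)" [1000])
hide_const (open) Matrix.mat Matrix.vec Matrix.row Matrix.rows

subsection \<open>Calculus\<close>

(* On open S this is C^k: all iterated directional derivatives up to order k exist and are
   continuous. *)
primrec Ck_on :: "nat \<Rightarrow> 'a::euclidean_space set \<Rightarrow> ('a \<Rightarrow> 'b::euclidean_space) \<Rightarrow> bool" where
  "Ck_on 0 S h \<longleftrightarrow> continuous_on S h"
| "Ck_on (Suc k) S h \<longleftrightarrow>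
     (\<forall>z\<in>S. h differentiable (at z)) \<and> (\<forall>v. Ck_on k S (\<lambda>z. frechet_derivative h (at z) v))"

definition grad :: "('a::euclidean_space \<Rightarrow> real) \<Rightarrow> 'a \<Rightarrow> 'a" where
  "grad h z = (THE D. GDERIV h z :> D)"

definition grad_y :: "(real \<times> (real^'m) \<Rightarrow> real) \<Rightarrow> real \<Rightarrow> real^'m \<Rightarrow> real^'m" where
  "grad_y h x y = grad (\<lambda>y'. h (x, y')) y"

definition hess_yy :: "(real \<times> (real^'m) \<Rightarrow> real) \<Rightarrow> real \<Rightarrow> real^'m \<Rightarrow> real^'m^'m" where
  "hess_yy h x y = jacobian (\<lambda>y'. grad_y h x y') (at y)"

subsection \<open>Linear algebra\<close>

(* Linear independence of a family; equal vectors with different indices are dependent. *)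
definition indep_family :: "('i \<Rightarrow> 'a::euclidean_space) \<Rightarrow> 'i set \<Rightarrow> bool" where
  "indep_family v I \<longleftrightarrow> inj_on v I \<and> independent (v ` I)"

(* bs lists the columns of a basis matrix V of the subspace W. *)
definition basis_list :: "(real^'m) list \<Rightarrow> (real^'m) set \<Rightarrow> bool" where
  "basis_list bs W \<longleftrightarrow> distinct bs \<and> independent (set bs) \<and> span (set bs) = W"

(* V^T H V for the matrix V with columns bs *)
definition reduced_mat :: "(real^'m) list \<Rightarrow> real^'m^'m \<Rightarrow> real Matrix.mat" where
  "reduced_mat bs H =
     Matrix.mat (length bs) (length bs) (\<lambda>(i, k). bs ! i \<bullet> (H *v (bs ! k)))"

(* V^T w for the matrix V with columns bs *)
definition reduced_vec :: "(real^'m) list \<Rightarrow> real^'m \<Rightarrow> real Matrix.vec" where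
  "reduced_vec bs w = Matrix.vec (length bs) (\<lambda>i. bs ! i \<bullet> w)"

definition nonsingular_on :: "real^'m^'m \<Rightarrow> (real^'m) set \<Rightarrow> bool" where
  "nonsingular_on H W \<longleftrightarrow> (\<exists>bs. basis_list bs W \<and> invertible_mat (reduced_mat bs H))"

subsection \<open>The lower level problem and the bilevel feasible set\<close>

definition feas :: "(real \<times> (real^'m) \<Rightarrow> real^'p) \<Rightarrow> real \<Rightarrow> (real^'m) set" where
  "feas g x = {y. g (x, y) \<le> 0}"

definition sols :: "(real \<times> (real^'m) \<Rightarrow> real) \<Rightarrow> (real \<times> (real^'m) \<Rightarrow> real^'p) \<Rightarrow> real \<Rightarrow> (real^'m) set"
  where "sols f g x = {y \<in> feas g x. \<forall>y'\<in>feas g x. f (x, y) \<le> f (x, y')}"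

(* Inf is unspecified on sets that are empty or unbounded below. Under the standing compactness
   assumption the latter do not occur, and the former only at x with feas g x = {}, over which
   the programs CP and CPFJ have no feasible point. *)
definition valfun :: "(real \<times> (real^'m) \<Rightarrow> real) \<Rightarrow> (real \<times> (real^'m) \<Rightarrow> real^'p) \<Rightarrow> real \<Rightarrow> real"
  where "valfun f g x = (INF y\<in>feas g x. f (x, y))"

definition bilevel_feas ::
    "(real \<times> (real^'m) \<Rightarrow> real) \<Rightarrow> (real \<times> (real^'m) \<Rightarrow> real^'p) \<Rightarrow> (real \<times> (real^'m)) set" where
  "bilevel_feas f g = {(x, y). y \<in> sols f g x}"

definition loc_minimizer ::
    "(real \<times> (real^'m) \<Rightarrow> real) \<Rightarrow> (real \<times> (real^'m) \<Rightarrow> real^'p) \<Rightarrow> real \<Rightarrow> real^'m \<Rightarrow> bool" where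
  "loc_minimizer f g x y \<longleftrightarrow>
     y \<in> feas g x \<and> (\<exists>e>0. \<forall>y'\<in>feas g x \<inter> ball y e. f (x, y) \<le> f (x, y'))"

definition active :: "(real \<times> (real^'m) \<Rightarrow> real^'p) \<Rightarrow> real \<Rightarrow> real^'m \<Rightarrow> 'p set" where
  "active g x y = {j. g (x, y) $ j = 0}"

abbreviation dgy :: "(real \<times> (real^'m) \<Rightarrow> real^'p) \<Rightarrow> real \<Rightarrow> real^'m \<Rightarrow> 'p \<Rightarrow> real^'m" where
  "dgy g x y j \<equiv> grad_y (\<lambda>z. g z $ j) x y"

definition kkt_multiplier ::
    "(real \<times> (real^'m) \<Rightarrow> real) \<Rightarrow> (real \<times> (real^'m) \<Rightarrow> real^'p) \<Rightarrow> real \<Rightarrow> real^'m \<Rightarrow> real^'p \<Rightarrow> bool"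
  where "kkt_multiplier f g x y u \<longleftrightarrow>
     0 \<le> u \<and> grad_y f x y + (\<Sum>i\<in>UNIV. (u $ i) *\<^sub>R dgy g x y i) = 0 \<and> u \<bullet> g (x, y) = 0"

definition kkt_holds ::
    "(real \<times> (real^'m) \<Rightarrow> real) \<Rightarrow> (real \<times> (real^'m) \<Rightarrow> real^'p) \<Rightarrow> real \<Rightarrow> real^'m \<Rightarrow> bool" where
  "kkt_holds f g x y \<longleftrightarrow> (\<exists>u. kkt_multiplier f g x y u)"

definition fj_multiplier ::
    "(real \<times> (real^'m) \<Rightarrow> real) \<Rightarrow> (real \<times> (real^'m) \<Rightarrow> real^'p) \<Rightarrow> real \<Rightarrow> real^'m
       \<Rightarrow> real \<Rightarrow> real^'p \<Rightarrow> bool"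
  where "fj_multiplier f g x y u0 u \<longleftrightarrow>
     0 \<le> u0 \<and> 0 \<le> u \<and>
     u0 *\<^sub>R grad_y f x y + (\<Sum>i\<in>UNIV. (u $ i) *\<^sub>R dgy g x y i) = 0 \<and>
     u \<bullet> g (x, y) = 0 \<and> \<bar>u0\<bar> + (\<Sum>i\<in>UNIV. \<bar>u $ i\<bar>) = 1"

definition licq :: "(real \<times> (real^'m) \<Rightarrow> real^'p) \<Rightarrow> real \<Rightarrow> real^'m \<Rightarrow> bool" where
  "licq g x y \<longleftrightarrow> indep_family (dgy g x y) (active g x y)"

definition mfcq :: "(real \<times> (real^'m) \<Rightarrow> real^'p) \<Rightarrow> real \<Rightarrow> real^'m \<Rightarrow> bool" where
  "mfcq g x y \<longleftrightarrow> (\<exists>d. \<forall>j\<in>active g x y. dgy g x y j \<bullet> d < 0)"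

subsection \<open>Types of generalized critical points\<close>

(* Multipliers carry no sign restriction; the multiplier vector has to be nonzero on the active
   set, since the components outside it do not enter the equation. *)
definition gen_critical ::
    "(real \<times> (real^'m) \<Rightarrow> real) \<Rightarrow> (real \<times> (real^'m) \<Rightarrow> real^'p) \<Rightarrow> real \<Rightarrow> real^'m \<Rightarrow> bool" where
  "gen_critical f g x y \<longleftrightarrow> y \<in> feas g x \<and>
     (\<exists>u0 u. (u0 \<noteq> 0 \<or> (\<exists>j\<in>active g x y. u j \<noteq> 0)) \<and>
        u0 *\<^sub>R grad_y f x y + (\<Sum>j\<in>active g x y. u j *\<^sub>R dgy g x y j) = 0)"

definition tangent ::
    "(real \<times> (real^'m) \<Rightarrow> real^'p) \<Rightarrow> real \<Rightarrow> real^'m \<Rightarrow> 'p set \<Rightarrow> (real^'m) set" where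
  "tangent g x y J = {\<xi>. \<forall>j\<in>J. dgy g x y j \<bullet> \<xi> = 0}"

(* Under LICQ there is exactly one such u, namely the vector called u-bar in the definitions of
   Types 1 and 2. *)
definition crit_multiplier ::
    "(real \<times> (real^'m) \<Rightarrow> real) \<Rightarrow> (real \<times> (real^'m) \<Rightarrow> real^'p) \<Rightarrow> real \<Rightarrow> real^'m \<Rightarrow> real^'p \<Rightarrow> bool"
  where "crit_multiplier f g x y u \<longleftrightarrow>
     grad_y f x y + (\<Sum>j\<in>active g x y. (u $ j) *\<^sub>R dgy g x y j) = 0 \<and>
     (\<forall>j. j \<notin> active g x y \<longrightarrow> u $ j = 0)"

definition hess_lagr ::
    "(real \<times> (real^'m) \<Rightarrow> real) \<Rightarrow> (real \<times> (real^'m) \<Rightarrow> real^'p) \<Rightarrow> real \<Rightarrow> real^'m \<Rightarrow> real^'p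
       \<Rightarrow> real^'m^'m"
  where "hess_lagr f g x y u = hess_yy (\<lambda>z. f z + u \<bullet> g z) x y"

definition type1 ::
    "(real \<times> (real^'m) \<Rightarrow> real) \<Rightarrow> (real \<times> (real^'m) \<Rightarrow> real^'p) \<Rightarrow> real \<Rightarrow> real^'m \<Rightarrow> bool" where
  "type1 f g x y \<longleftrightarrow> gen_critical f g x y \<and> licq g x y \<and>
     (\<exists>u. crit_multiplier f g x y u \<and>
        (\<forall>j\<in>active g x y. u $ j \<noteq> 0) \<and>
        nonsingular_on (hess_lagr f g x y u) (tangent g x y (active g x y)))"

(* By the implicit function theorem the germ of (yt, ut) at xb is determined by these conditions;
   the components of ut outside J, which do not enter the system, are set to zero. *)
definition crit_branch ::
    "(real \<times> (real^'m) \<Rightarrow> real) \<Rightarrow> (real \<times> (real^'m) \<Rightarrow> real^'p) \<Rightarrow> 'p set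
       \<Rightarrow> real \<Rightarrow> real^'m \<Rightarrow> real^'p \<Rightarrow> (real \<Rightarrow> real^'m) \<Rightarrow> (real \<Rightarrow> real^'p) \<Rightarrow> bool"
  where "crit_branch f g J xb yb ub yt ut \<longleftrightarrow> yt xb = yb \<and> ut xb = ub \<and>
     (\<exists>e>0. Ck_on 2 (ball xb e) yt \<and> Ck_on 2 (ball xb e) ut \<and>
        (\<forall>x\<in>ball xb e.
           grad_y f x (yt x) + (\<Sum>j\<in>J. (ut x $ j) *\<^sub>R dgy g x (yt x) j) = 0 \<and>
           (\<forall>j\<in>J. g (x, yt x) $ j = 0) \<and> (\<forall>j. j \<notin> J \<longrightarrow> ut x $ j = 0)))"

definition type2 ::
    "(real \<times> (real^'m) \<Rightarrow> real) \<Rightarrow> (real \<times> (real^'m) \<Rightarrow> real^'p) \<Rightarrow> real \<Rightarrow> real^'m \<Rightarrow> bool" where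
  "type2 f g x y \<longleftrightarrow> gen_critical f g x y \<and> licq g x y \<and>
     (\<exists>u q. crit_multiplier f g x y u \<and>
        {j \<in> active g x y. u $ j = 0} = {q} \<and>
        nonsingular_on (hess_lagr f g x y u) (tangent g x y (active g x y)) \<and>
        nonsingular_on (hess_lagr f g x y u) (tangent g x y (active g x y - {q})) \<and>
        (\<exists>yt ut. crit_branch f g (active g x y - {q}) x y u yt ut \<and>
           deriv (\<lambda>t. g (t, yt t) $ q) x \<noteq> 0))"

(* All conditions are invariant under scaling of l, and A, b depend on the basis bs only up to
   congruence, so the existential quantifiers do not lose anything. *)
definition type4 ::
    "(real \<times> (real^'m) \<Rightarrow> real) \<Rightarrow> (real \<times> (real^'m) \<Rightarrow> real^'p) \<Rightarrow> real \<Rightarrow> real^'m \<Rightarrow> bool" where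
  "type4 f g x y \<longleftrightarrow> gen_critical f g x y \<and>
     (let J = active g x y in
        1 \<le> card J \<and> dim (dgy g x y ` J) = card J - 1 \<and> card J - 1 < CARD('m) \<and>
        (\<exists>l. (\<Sum>j\<in>J. l j *\<^sub>R dgy g x y j) = 0 \<and> (\<forall>j\<in>J. l j \<noteq> 0) \<and>
           (\<Sum>j\<in>J. l j * deriv (\<lambda>t. g (t, y) $ j) x) \<noteq> 0 \<and>
           (\<exists>bs. basis_list bs (tangent g x y J) \<and>
              (let A = reduced_mat bs (hess_yy (\<lambda>z. \<Sum>j\<in>J. l j * g z $ j) x y);
                   b = reduced_vec bs (grad_y f x y)
               in \<exists>Ainv. inverts_mat A Ainv \<and> inverts_mat Ainv A \<and>
                    scalar_prod b (Ainv *\<^sub>v b) \<noteq> 0))))"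

definition type5 ::
    "(real \<times> (real^'m) \<Rightarrow> real) \<Rightarrow> (real \<times> (real^'m) \<Rightarrow> real^'p) \<Rightarrow> real \<Rightarrow> real^'m \<Rightarrow> bool" where
  "type5 f g x y \<longleftrightarrow> gen_critical f g x y \<and>
     (let J = active g x y in
        card J = CARD('m) + 1 \<and>
        indep_family (\<lambda>j. grad (\<lambda>z. g z $ j) (x, y)) J \<and>
        (\<forall>K\<subseteq>J. card K = CARD('m) \<longrightarrow> indep_family (dgy g x y) K) \<and>
        (\<forall>i\<in>J. \<exists>u. grad_y f x y + (\<Sum>j\<in>J - {i}. u j *\<^sub>R dgy g x y j) = 0 \<and>
           (\<forall>j\<in>J - {i}. u j \<noteq> 0)))"

definition type5_1 ::
    "(real \<times> (real^'m) \<Rightarrow> real) \<Rightarrow> (real \<times> (real^'m) \<Rightarrow> real^'p) \<Rightarrow> real \<Rightarrow> real^'m \<Rightarrow> bool" where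
  "type5_1 f g x y \<longleftrightarrow> type5 f g x y \<and> \<not> mfcq g x y \<and> kkt_holds f g x y"

definition type5_2 ::
    "(real \<times> (real^'m) \<Rightarrow> real) \<Rightarrow> (real \<times> (real^'m) \<Rightarrow> real^'p) \<Rightarrow> real \<Rightarrow> real^'m \<Rightarrow> bool" where
  "type5_2 f g x y \<longleftrightarrow> type5 f g x y \<and> mfcq g x y"

subsection \<open>Simple bilevel programs\<close>

(* The neighbourhood ball yb r must not depend on t. For a minimizer yb of Type 1 the germ of yk
   at xb is determined by these conditions. *)
definition min_branch ::
    "(real \<times> (real^'m) \<Rightarrow> real) \<Rightarrow> (real \<times> (real^'m) \<Rightarrow> real^'p) \<Rightarrow> real \<Rightarrow> real^'m
       \<Rightarrow> (real \<Rightarrow> real^'m) \<Rightarrow> bool"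
  where "min_branch f g xb yb yk \<longleftrightarrow> yk xb = yb \<and>
     (\<exists>d>0. \<exists>r>0. \<forall>t\<in>ball xb d. yk t \<in> ball yb r \<and> loc_minimizer f g t (yk t) \<and>
        (\<forall>y\<in>ball yb r. loc_minimizer f g t y \<longrightarrow> y = yk t))"

definition simple_case1 ::
    "(real \<times> (real^'m) \<Rightarrow> real) \<Rightarrow> (real \<times> (real^'m) \<Rightarrow> real^'p) \<Rightarrow> real \<Rightarrow> real^'m \<Rightarrow> bool" where
  "simple_case1 f g x y \<longleftrightarrow> sols f g x = {y} \<and>
     (type1 f g x y \<or> type2 f g x y \<or> type4 f g x y \<or> type5_1 f g x y \<or> type5_2 f g x y)"

definition simple_case2 ::
    "(real \<times> (real^'m) \<Rightarrow> real) \<Rightarrow> (real \<times> (real^'m) \<Rightarrow> real^'p) \<Rightarrow> real \<Rightarrow> bool" where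
  "simple_case2 f g x \<longleftrightarrow>
     (\<exists>ya yb. ya \<noteq> yb \<and> sols f g x = {ya, yb} \<and> type1 f g x ya \<and> type1 f g x yb \<and>
        (\<exists>y1 y2. min_branch f g x ya y1 \<and> min_branch f g x yb y2 \<and>
           deriv (\<lambda>t. f (t, y2 t) - f (t, y1 t)) x \<noteq> 0))"

definition simple_at ::
    "(real \<times> (real^'m) \<Rightarrow> real) \<Rightarrow> (real \<times> (real^'m) \<Rightarrow> real^'p) \<Rightarrow> real \<Rightarrow> real^'m \<Rightarrow> bool" where
  "simple_at f g x y \<longleftrightarrow> (x, y) \<in> bilevel_feas f g \<and> (simple_case1 f g x y \<or> simple_case2 f g x)"

subsection \<open>Mathematical programs with complementarity constraints\<close>

(* minimize cost z  s.t.  equ i z = 0,  ineq j z <= 0,  sgn_var k z >= 0,  compl z = 0,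
   where compl is the complementarity product u^T g *)
record ('z, 'e, 'i, 'k) mpcc =
  cost :: "'z \<Rightarrow> real"
  equ :: "'e \<Rightarrow> 'z \<Rightarrow> real"
  ineq :: "'i \<Rightarrow> 'z \<Rightarrow> real"
  sgn_var :: "'k \<Rightarrow> 'z \<Rightarrow> real"
  compl :: "'z \<Rightarrow> real"

definition mpcc_feasible :: "('z, 'e, 'i, 'k) mpcc \<Rightarrow> 'z \<Rightarrow> bool" where
  "mpcc_feasible P z \<longleftrightarrow> (\<forall>i. equ P i z = 0) \<and> (\<forall>j. ineq P j z \<le> 0) \<and>
     (\<forall>k. 0 \<le> sgn_var P k z) \<and> compl P z = 0"

definition mpcc_active :: "('z, 'e, 'i, 'k) mpcc \<Rightarrow> 'z \<Rightarrow> ('e + 'i + 'k) set" where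
  "mpcc_active P z = range Inl \<union> (Inr \<circ> Inl) ` {j. ineq P j z = 0}
     \<union> (Inr \<circ> Inr) ` {k. sgn_var P k z = 0}"

definition mpcc_grad :: "('z::euclidean_space, 'e, 'i, 'k) mpcc \<Rightarrow> 'z \<Rightarrow> 'e + 'i + 'k \<Rightarrow> 'z" where
  "mpcc_grad P z = case_sum (\<lambda>i. grad (equ P i) z)
     (case_sum (\<lambda>j. grad (ineq P j) z) (\<lambda>k. grad (sgn_var P k) z))"

definition mpcc_licq :: "('z::euclidean_space, 'e, 'i, 'k) mpcc \<Rightarrow> 'z \<Rightarrow> bool" where
  "mpcc_licq P z \<longleftrightarrow> mpcc_feasible P z \<and> indep_family (mpcc_grad P z) (mpcc_active P z)"

definition CP ::
    "(real \<times> (real^'m) \<Rightarrow> real) \<Rightarrow> (real \<times> (real^'m) \<Rightarrow> real) \<Rightarrow> (real \<times> (real^'m) \<Rightarrow> real^'p) \<Rightarrow> real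
       \<Rightarrow> (real \<times> (real^'m) \<times> (real^'p), 'm, 'p, 'p) mpcc"
  where "CP F f g \<mu> =
     \<lparr> cost = (\<lambda>(x, y, u). F (x, y) + \<mu> * (f (x, y) - valfun f g x)),
       equ = (\<lambda>i (x, y, u). (grad_y f x y + (\<Sum>j\<in>UNIV. (u $ j) *\<^sub>R dgy g x y j)) $ i),
       ineq = (\<lambda>j (x, y, u). g (x, y) $ j),
       sgn_var = (\<lambda>k (x, y, u). u $ k),
       compl = (\<lambda>(x, y, u). u \<bullet> g (x, y)) \<rparr>"

(* Equation index None is the normalization u_0 + ... + u_p = 1; sign index None is u_0 >= 0. *)
definition CPFJ ::
    "(real \<times> (real^'m) \<Rightarrow> real) \<Rightarrow> (real \<times> (real^'m) \<Rightarrow> real) \<Rightarrow> (real \<times> (real^'m) \<Rightarrow> real^'p) \<Rightarrow> real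
       \<Rightarrow> (real \<times> (real^'m) \<times> real \<times> (real^'p), 'm option, 'p, 'p option) mpcc"
  where "CPFJ F f g \<mu> =
     \<lparr> cost = (\<lambda>(x, y, u0, u). F (x, y) + \<mu> * (f (x, y) - valfun f g x)),
       equ = (\<lambda>c (x, y, u0, u). case c of
           None \<Rightarrow> u0 + (\<Sum>j\<in>UNIV. u $ j) - 1
         | Some i \<Rightarrow> (u0 *\<^sub>R grad_y f x y + (\<Sum>j\<in>UNIV. (u $ j) *\<^sub>R dgy g x y j)) $ i),
       ineq = (\<lambda>j (x, y, u0, u). g (x, y) $ j),
       sgn_var = (\<lambda>c (x, y, u0, u). case c of None \<Rightarrow> u0 | Some k \<Rightarrow> u $ k),
       compl = (\<lambda>(x, y, u0, u). u \<bullet> g (x, y)) \<rparr>"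

end

(* A linear relation between the gradients amounts to a vector v (multiplying the stationarity
   equation), weights w on the active constraints and weights on the vanishing multipliers, such
   that its pairing with every direction vanishes. Pairing with the multiplier directions shows
   that v is orthogonal to grad_y g_j whenever u_j is nonzero, and that the weights on the vanishing
   multipliers are determined by v; it remains to see v = 0 and w = 0. For Type 1 the
   nonsingular reduced Hessian kills v and LICQ kills w. For Type 2 the pairing with the velocity of
   the critical branch first removes the weight of the constraint with zero multiplier. For Type 5 at
   least m components of u are nonzero, so v = 0 at once, and independence of the full gradients
   gives w = 0. At a point of Type 4 the KKT condition fails because b is nonzero; the FJ multiplier
   is proportional to lambda, which first eliminates the normalization, then v, and leaves w
   proportional to lambda, hence zero by the condition on the x-derivatives. *)
theory Submission
  imports Defs
begin

subsection \<open>Linear algebra\<close>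

text \<open>A relation among the images pulls back along the injective \<open>v\<close>; conversely
  a coincidence of two members is itself a nontrivial relation.\<close>

lemma indep_family_iff:
  fixes v :: "'i \<Rightarrow> 'a::euclidean_space"
  assumes "finite I"
  shows "indep_family v I \<longleftrightarrow> (\<forall>c. (\<Sum>i\<in>I. c i *\<^sub>R v i) = 0 \<longrightarrow> (\<forall>i\<in>I. c i = 0))"
    (is "_ \<longleftrightarrow> ?R")
proof
  assume "indep_family v I"
  then have inj: "inj_on v I" and ind: "independent (v ` I)"
    by (auto simp: indep_family_def)
  show ?R
  proof (intro allI impI ballI)
    fix c i
    assume s: "(\<Sum>i\<in>I. c i *\<^sub>R v i) = 0" and i: "i \<in> I"
    have "(\<Sum>w\<in>v ` I. c (the_inv_into I v w) *\<^sub>R w) = (\<Sum>i\<in>I. c i *\<^sub>R v i)"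
      by (subst sum.reindex[OF inj]) (auto intro!: sum.cong simp: the_inv_into_f_f[OF inj])
    with s have "(\<Sum>w\<in>v ` I. c (the_inv_into I v w) *\<^sub>R w) = 0"
      by simp
    with ind have "\<forall>w\<in>v ` I. c (the_inv_into I v w) = 0"
      unfolding independent_explicit by (elim conjE allE[of _ "c \<circ> the_inv_into I v"]) simp
    with i have "c (the_inv_into I v (v i)) = 0"
      by blast
    then show "c i = 0"
      by (simp add: the_inv_into_f_f[OF inj i])
  qed
next
  assume R: ?R
  have inj: "inj_on v I"
  proof (rule inj_onI, rule ccontr)
    fix i k
    assume *: "i \<in> I" "k \<in> I" "v i = v k" "i \<noteq> k"
    \<comment> \<open>The relation \<open>v i - v k = 0\<close>: coefficient 1 at \<open>i\<close>
      and -1 at \<open>k\<close>.\<close>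
    define c :: "'i \<Rightarrow> real" where "c j = (if j = i then 1 else 0) - (if j = k then 1 else 0)" for j
    have "(\<Sum>j\<in>I. c j *\<^sub>R v j) = 0"
      using * assms by (simp add: c_def scaleR_diff_left sum_subtractf if_distrib[of "\<lambda>r. r *\<^sub>R _"]
          sum.delta' sum.delta cong: if_cong)
    with R * have "c i = 0"
      by blast
    with * show False
      by (simp add: c_def)
  qed
  moreover have "independent (v ` I)"
    unfolding independent_explicit
  proof (intro conjI allI impI)
    show "finite (v ` I)"
      using assms by simp
    fix c
    assume "(\<Sum>w\<in>v ` I. c w *\<^sub>R w) = 0"
    then have "(\<Sum>i\<in>I. c (v i) *\<^sub>R v i) = 0"
      by (simp add: sum.reindex[OF inj])
    with R[rule_format, of "c \<circ> v"] show "\<forall>w\<in>v ` I. c w = 0"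
      by simp
  qed
  ultimately show "indep_family v I"
    by (simp add: indep_family_def)
qed

lemmas indep_familyD = indep_family_iff[THEN iffD1, rule_format]

lemma indep_family_coeff_unique:
  fixes a :: "'i \<Rightarrow> 'a::euclidean_space"
  assumes "indep_family a J" "finite J"
    and "(\<Sum>j\<in>J. c j *\<^sub>R a j) = (\<Sum>j\<in>J. d j *\<^sub>R a j)" and "j \<in> J"
  shows "c j = d j"
proof -
  have "(\<Sum>j\<in>J. (c j - d j) *\<^sub>R a j) = 0"
    using assms(3) by (simp add: scaleR_diff_left sum_subtractf)
  from indep_familyD[OF assms(2,1) this assms(4)] show ?thesis
    by simp
qed

text \<open>A nonzero coefficient \<open>l k\<close> puts \<open>a k\<close> in the span of the
  others, so dropping it keeps the dimension \<open>card J - 1\<close>, and the remaining family is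
  independent. Subtracting the right multiple of \<open>l\<close> from \<open>u\<close> leaves a
  relation on that family.\<close>

lemma relation_unique_up_to_scaling:
  fixes a :: "'i \<Rightarrow> 'a::euclidean_space"
  assumes "finite J" and "dim (a ` J) = card J - 1"
    and l: "(\<Sum>j\<in>J. l j *\<^sub>R a j) = 0" "\<And>j. j \<in> J \<Longrightarrow> l j \<noteq> 0"
    and u: "(\<Sum>j\<in>J. u j *\<^sub>R a j) = 0"
  shows "\<exists>c. \<forall>j\<in>J. u j = c * l j"
proof (cases "J = {}")
  case False
  then obtain k where k: "k \<in> J"
    by blast
  define K where "K = J - {k}"
  have J: "J = insert k K" "k \<notin> K" and [simp]: "finite K"
    using k assms(1) by (auto simp: K_def)
  have "l k *\<^sub>R a k = - (\<Sum>j\<in>K. l j *\<^sub>R a j)"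
    using l(1) J by (simp add: eq_neg_iff_add_eq_0)
  moreover have "- (\<Sum>j\<in>K. l j *\<^sub>R a j) \<in> span (a ` K)"
    by (intro span_neg span_sum span_scale) (simp add: span_base)
  ultimately have "l k *\<^sub>R a k \<in> span (a ` K)"
    by simp
  then have ak: "a k \<in> span (a ` K)"
    using l(2)[OF k] span_scale[of "l k *\<^sub>R a k" _ "1 / l k"] by simp
  have "card K = dim (a ` K)"
    using assms(2) J ak by (simp add: dim_insert)
  then have cK: "card (a ` K) = card K"
    using card_image_le[of K a] dim_le_card'[of "a ` K"] by simp
  have "independent (a ` K)"
    by (rule card_le_dim_spanning[of _ "a ` K"])
      (use \<open>card K = dim (a ` K)\<close> cK in \<open>auto intro: span_base\<close>)
  moreover have "inj_on a K"
    using cK by (simp add: eq_card_imp_inj_on)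
  ultimately have ind: "indep_family a K"
    by (simp add: indep_family_def)
  \<comment> \<open>Chosen so that \<open>u - c l\<close> has coefficient 0 at the dropped index
    \<open>k\<close>.\<close>
  define c where "c = u k / l k"
  have "(\<Sum>j\<in>J. (u j - c * l j) *\<^sub>R a j) = (\<Sum>j\<in>J. u j *\<^sub>R a j) - c *\<^sub>R (\<Sum>j\<in>J. l j *\<^sub>R a j)"
    by (simp add: scaleR_diff_left sum_subtractf scaleR_sum_right)
  then have "(\<Sum>j\<in>K. (u j - c * l j) *\<^sub>R a j) = 0"
    unfolding l(1) u using J l(2)[OF k] by (simp add: c_def)
  from indep_familyD[OF _ ind this] have "\<forall>j\<in>K. u j = c * l j"
    by auto
  moreover have "u k = c * l k"
    using l(2)[OF k] by (simp add: c_def)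
  ultimately show ?thesis
    using J by auto
qed simp

text \<open>Independence allows a linear functional with the prescribed values;
  \<open>adjoint \<phi> 1\<close> is the vector representing it. This supplies descent directions
  under LICQ.\<close>

lemma indep_family_solve:
  fixes a :: "'i \<Rightarrow> 'a::euclidean_space"
  assumes "indep_family a J"
  shows "\<exists>d. \<forall>j\<in>J. a j \<bullet> d = r j"
proof -
  have inj: "inj_on a J" and ind: "independent (a ` J)"
    using assms by (auto simp: indep_family_def)
  obtain \<phi> :: "'a \<Rightarrow> real" where \<phi>: "linear \<phi>" "\<forall>w\<in>a ` J. \<phi> w = r (the_inv_into J a w)"
    using linear_independent_extend[OF ind, of "\<lambda>w. r (the_inv_into J a w)"] by blast
  have "a j \<bullet> adjoint \<phi> 1 = r j" if "j \<in> J" for j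
    using adjoint_works[OF \<phi>(1), of "a j" 1] \<phi>(2) that by (simp add: the_inv_into_f_f[OF inj])
  then show ?thesis
    by blast
qed

text \<open>The family spans the whole space, so \<open>v\<close> is orthogonal to itself.\<close>

lemma indep_family_full_orthogonal:
  fixes a :: "'i \<Rightarrow> 'a::euclidean_space"
  assumes "indep_family a K" and "card K = DIM('a)" and "\<And>j. j \<in> K \<Longrightarrow> a j \<bullet> v = 0"
  shows "v = 0"
proof -
  have "card (a ` K) = DIM('a)" "independent (a ` K)"
    using assms by (auto simp: indep_family_def card_image)
  then have "span (a ` K) = UNIV"
    by (metis dim_eq_full dim_eq_card_independent)
  moreover have "orthogonal v w" if "w \<in> span (a ` K)" for w
    using that by (rule orthogonal_to_span) (use assms(3) in \<open>auto simp: orthogonal_def inner_commute\<close>)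
  ultimately show ?thesis
    by (metis UNIV_I orthogonal_self)
qed

text \<open>Orthogonality says that the coordinate row of \<open>v\<close> in the basis
  \<open>bs\<close> annihilates the reduced matrix from the left; multiplying by the inverse on the
  right makes the coordinates vanish.\<close>

lemma reduced_mat_left_kernel:
  assumes bs: "basis_list bs W"
    and inv: "inverts_mat (reduced_mat bs H) B" "inverts_mat B (reduced_mat bs H)"
    and v: "v \<in> W" and orth: "\<And>d. d \<in> W \<Longrightarrow> v \<bullet> (H *v d) = 0"
  shows "v = 0"
proof -
  define n where "n = length bs"
  have dimM: "dim_row (reduced_mat bs H) = n" "dim_col (reduced_mat bs H) = n"
    by (auto simp: reduced_mat_def n_def)
  have M: "reduced_mat bs H * B = 1\<^sub>m n" and BM: "B * reduced_mat bs H = 1\<^sub>m (dim_row B)"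
    using inv dimM by (auto simp: inverts_mat_def)
  \<comment> \<open>\<open>inverts_mat\<close> does not fix the size of \<open>B\<close>; comparing
    column counts in both products does.\<close>
  have dimB: "dim_row B = n" "dim_col B = n"
    using arg_cong[OF BM, of dim_col] arg_cong[OF M, of dim_col] dimM by auto
  have dist: "distinct bs" and ind: "independent (set bs)" and sp: "span (set bs) = W"
    using bs by (auto simp: basis_list_def)
  have bsW: "bs ! k \<in> W" if "k < n" for k
    using sp that by (auto simp: n_def intro: span_base)
  obtain c where "v = (\<Sum>w\<in>set bs. c w *\<^sub>R w)"
    using v sp span_finite[of "set bs"] by auto
  also have "\<dots> = (\<Sum>i<n. c (bs ! i) *\<^sub>R bs ! i)"
    using sum.reindex_bij_betw[OF bij_betw_nth[OF dist refl refl], of "\<lambda>w. c w *\<^sub>R w"]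
    by (simp add: n_def)
  finally have vc: "v = (\<Sum>i<n. c (bs ! i) *\<^sub>R bs ! i)" .
  have "c (bs ! l) = 0" if l: "l < n" for l
  proof -
    have col: "(\<Sum>i<n. c (bs ! i) * reduced_mat bs H $$ (i, k)) = 0" if "k < n" for k
    proof -
      have "(\<Sum>i<n. c (bs ! i) * reduced_mat bs H $$ (i, k)) = v \<bullet> (H *v bs ! k)"
        unfolding vc using that by (simp add: inner_sum_left reduced_mat_def n_def)
      then show ?thesis
        using orth bsW[OF that] by simp
    qed
    have "c (bs ! l) = (\<Sum>i<n. c (bs ! i) * (1\<^sub>m n :: real Matrix.mat) $$ (i, l))"
      using l by (subst sum.remove[of _ l]) auto
    also have "\<dots> = (\<Sum>i<n. c (bs ! i) * (\<Sum>k<n. reduced_mat bs H $$ (i, k) * B $$ (k, l)))"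
      using l dimM dimB unfolding M[symmetric]
      by (intro sum.cong) (simp_all add: scalar_prod_def atLeast0LessThan)
    also have "\<dots> = (\<Sum>k<n. (\<Sum>i<n. c (bs ! i) * reduced_mat bs H $$ (i, k)) * B $$ (k, l))"
      unfolding sum_distrib_left sum_distrib_right by (subst sum.swap) (simp add: mult.assoc)
    also have "\<dots> = 0"
      using col by simp
    finally show ?thesis .
  qed
  then show ?thesis
    unfolding vc by simp
qed

lemma nonsingular_onD:
  assumes "nonsingular_on H W" and "v \<in> W" and "\<And>d. d \<in> W \<Longrightarrow> v \<bullet> (H *v d) = 0"
  shows "v = 0"
  using assms reduced_mat_left_kernel unfolding nonsingular_on_def invertible_mat_def by metis

subsection \<open>Gradients and stationarity\<close>

text \<open>\<open>adjoint h' 1\<close> represents the derivative, and uniqueness of derivatives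
  makes it the only candidate for the description in \<open>grad\<close>.\<close>

lemma grad_inner:
  assumes "(h has_derivative h') (at z)"
  shows "grad h z \<bullet> d = h' d"
proof -
  have eq: "d \<bullet> adjoint h' 1 = h' d" for d
    using adjoint_works[OF has_derivative_linear[OF assms], of d 1] by simp
  have G: "GDERIV h z :> adjoint h' 1"
    using assms by (simp add: gderiv_def eq)
  have "grad h z = adjoint h' 1"
    unfolding grad_def
  proof (rule the_equality, rule G)
    fix D assume "GDERIV h z :> D"
    then have "(\<lambda>d. d \<bullet> D) = h'"
      using assms has_derivative_unique unfolding gderiv_def by blast
    then show "D = adjoint h' 1"
      by (metis eq vector_eq_rdot inner_commute)
  qed
  then show ?thesis
    by (simp add: inner_commute eq)
qed

lemma grad_y_inner:
  assumes "h differentiable at (x, y)"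
  shows "grad_y h x y \<bullet> d = frechet_derivative h (at (x, y)) (0, d)"
proof -
  have *: "(h has_derivative frechet_derivative h (at (x, y))) (at (x, y))"
    using assms by (simp add: frechet_derivative_works)
  have "((\<lambda>y'. h (x, y')) has_derivative (\<lambda>d. frechet_derivative h (at (x, y)) (0, d))) (at y)"
    by (rule has_derivative_compose[of "\<lambda>y'. (x, y')", OF _ *]) (auto intro!: derivative_eq_intros)
  then show ?thesis
    unfolding grad_y_def by (rule grad_inner)
qed

section \<open>Consequences of continuous differentiability\<close>

lemma Ck_on_SucD: "Ck_on (Suc k) S h \<Longrightarrow> Ck_on k S h"
proof (induction k arbitrary: h)
  case 0
  then show ?case
    by (metis Ck_on.simps differentiable_at_withinI differentiable_imp_continuous_on
        differentiable_on_def)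
next
  case (Suc k)
  then show ?case
    by (metis Ck_on.simps(2))
qed

lemma Ck_on_component:
  fixes h :: "'a::euclidean_space \<Rightarrow> real^'p"
  shows "Ck_on k UNIV h \<Longrightarrow> Ck_on k UNIV (\<lambda>z. h z $ j)"
proof (induction k arbitrary: h)
  case 0
  then show ?case
    by (auto intro!: continuous_intros)
next
  case (Suc k)
  then have D: "((\<lambda>z. h z $ j) has_derivative (\<lambda>v. frechet_derivative h (at z) v $ j)) (at z)" for z
    by (intro bounded_linear.has_derivative[OF bounded_linear_vec_nth])
      (simp add: frechet_derivative_works)
  have "frechet_derivative (\<lambda>z. h z $ j) (at z) v = frechet_derivative h (at z) v $ j" for z v
    using frechet_derivative_at[OF D] by metis
  then show ?case
    using Suc.prems Suc.IH differentiableI[OF D] by simp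
qed

lemma Ck_on_2_differentiable:
  assumes "Ck_on 2 UNIV h"
  shows "h differentiable at z" "(\<lambda>z. frechet_derivative h (at z) v) differentiable at z"
  using assms by (auto simp: numeral_2_eq_2)

text \<open>Componentwise the partial gradient is a directional derivative of \<open>h\<close> in a
  direction \<open>(0, b)\<close>, which is differentiable for \<open>h\<close> of class
  C^2.\<close>

lemma grad_y_differentiable:
  fixes h :: "real \<times> (real^'m) \<Rightarrow> real"
  assumes "Ck_on 2 UNIV h"
  shows "(\<lambda>z. grad_y h (fst z) (snd z)) differentiable at z"
proof -
  have "(\<lambda>z. grad_y h (fst z) (snd z) \<bullet> b) = (\<lambda>z. frechet_derivative h (at z) (0, b))" for b
    using grad_y_inner[OF Ck_on_2_differentiable(1)[OF assms]] by fastforce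
  then show ?thesis
    using Ck_on_2_differentiable(2)[OF assms] by (subst differentiable_componentwise_within) simp
qed

text \<open>The y-gradient of \<open>u0 f + u^T g\<close> at fixed multipliers. It is linear in
  \<open>(u0, u)\<close>, so the same map describes the equation of \<open>CP\<close>
  (\<open>u0 = 1\<close>), that of \<open>CPFJ\<close>, and the derivatives of both in multiplier
  directions.\<close>

definition stat ::
    "(real \<times> (real^'m) \<Rightarrow> real) \<Rightarrow> (real \<times> (real^'m) \<Rightarrow> real^'p) \<Rightarrow> real \<Rightarrow> real^'p
       \<Rightarrow> real \<times> (real^'m) \<Rightarrow> real^'m" where
  "stat f g u0 u z = u0 *\<^sub>R grad_y f (fst z) (snd z)
     + (\<Sum>j\<in>UNIV. (u $ j) *\<^sub>R dgy g (fst z) (snd z) j)"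

abbreviation Dstat where
  "Dstat f g u0 u z \<equiv> frechet_derivative (stat f g u0 u) (at z)"

text \<open>Product rule: by linearity in the multipliers, a multiplier increment
  \<open>(du0, du)\<close> contributes \<open>stat\<close> evaluated at that increment.\<close>

lemma has_derivative_stat:
  fixes f :: "real \<times> (real^'m) \<Rightarrow> real" and g :: "real \<times> (real^'m) \<Rightarrow> real^'p"
  assumes f: "Ck_on 2 UNIV f" and g: "Ck_on 2 UNIV g"
  shows "(stat f g u0 u has_derivative Dstat f g u0 u z) (at z)"
    and "((\<lambda>(z, u0, u). stat f g u0 u z) has_derivative
           (\<lambda>(dz, du0, du). Dstat f g u0 u z dz + stat f g du0 du z)) (at (z, u0, u))"
proof -
  define A where "A = frechet_derivative (\<lambda>z. grad_y f (fst z) (snd z)) (at z)"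
  define B where "B j = frechet_derivative (\<lambda>z. dgy g (fst z) (snd z) j) (at z)" for j
  have A: "((\<lambda>z. grad_y f (fst z) (snd z)) has_derivative A) (at z)"
    using grad_y_differentiable[OF f] by (simp add: A_def frechet_derivative_works[symmetric])
  have B: "((\<lambda>z. dgy g (fst z) (snd z) j) has_derivative B j) (at z)" for j
    using grad_y_differentiable[OF Ck_on_component[OF g]]
    by (simp add: B_def frechet_derivative_works[symmetric])
  have S: "(stat f g u0 u has_derivative (\<lambda>d. u0 *\<^sub>R A d + (\<Sum>j\<in>UNIV. (u $ j) *\<^sub>R B j d))) (at z)"
    unfolding stat_def[abs_def] by (intro derivative_intros A B)
  have D: "Dstat f g u0 u z = (\<lambda>d. u0 *\<^sub>R A d + (\<Sum>j\<in>UNIV. (u $ j) *\<^sub>R B j d))"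
    using frechet_derivative_at[OF S] by simp
  show "(stat f g u0 u has_derivative Dstat f g u0 u z) (at z)"
    using S D by simp
  have A': "((\<lambda>w. grad_y f (fst (fst w)) (snd (fst w))) has_derivative (\<lambda>d. A (fst d)))
      (at (z, u0, u))"
    by (rule has_derivative_compose[of fst]) (auto intro!: derivative_eq_intros A)
  have B': "((\<lambda>w. dgy g (fst (fst w)) (snd (fst w)) j) has_derivative (\<lambda>d. B j (fst d)))
      (at (z, u0, u))" for j
    by (rule has_derivative_compose[of fst]) (auto intro!: derivative_eq_intros B)
  have U: "((\<lambda>w :: ((real \<times> (real^'m)) \<times> real \<times> (real^'p)). snd (snd w) $ j) has_derivative (\<lambda>d. snd (snd d) $ j))
      (at (z, u0, u))" for j
    by (intro bounded_linear.has_derivative[OF bounded_linear_vec_nth] derivative_intros)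
  show "((\<lambda>(z, u0, u). stat f g u0 u z) has_derivative
      (\<lambda>(dz, du0, du). Dstat f g u0 u z dz + stat f g du0 du z)) (at (z, u0, u))"
    unfolding D unfolding stat_def[abs_def] case_prod_beta'
    by (rule derivative_eq_intros A' B' U refl)+
      (simp add: sum.distrib algebra_simps fun_eq_iff)
qed

lemma hess_yy_mult:
  fixes h :: "real \<times> (real^'m) \<Rightarrow> real"
  assumes "\<And>y'. grad_y h x y' = \<Phi> (x, y')" and \<Phi>: "(\<Phi> has_derivative \<Phi>') (at (x, y))"
  shows "hess_yy h x y *v d = \<Phi>' (0, d)"
proof -
  have *: "((\<lambda>y'. \<Phi> (x, y')) has_derivative (\<lambda>d. \<Phi>' (0, d))) (at y)"
    by (rule has_derivative_compose[of "\<lambda>y'. (x, y')", OF _ \<Phi>]) (auto intro!: derivative_eq_intros)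
  have "((\<lambda>y'. \<Phi> (x, y')) has_derivative (\<lambda>d. jacobian (\<lambda>y'. \<Phi> (x, y')) (at y) *v d)) (at y)"
    using * by (simp add: jacobian_works[symmetric] differentiableI)
  from has_derivative_unique[OF this *] show ?thesis
    using assms(1) by (simp add: hess_yy_def fun_eq_iff)
qed

lemma grad_y_lin_comb:
  fixes f :: "real \<times> (real^'m) \<Rightarrow> real" and g :: "real \<times> (real^'m) \<Rightarrow> real^'p"
  assumes f: "Ck_on 2 UNIV f" and g: "Ck_on 2 UNIV g"
  shows "grad_y (\<lambda>z. u0 * f z + u \<bullet> g z) x y = stat f g u0 u (x, y)"
proof -
  have F: "(f has_derivative frechet_derivative f (at z)) (at z)" for z
    using Ck_on_2_differentiable[OF f] by (simp add: frechet_derivative_works[symmetric])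
  have G: "((\<lambda>z. g z $ j) has_derivative frechet_derivative (\<lambda>z. g z $ j) (at z)) (at z)" for j z
    using Ck_on_2_differentiable[OF Ck_on_component[OF g]]
    by (simp add: frechet_derivative_works[symmetric])
  have L: "((\<lambda>z. u0 * f z + u \<bullet> g z) has_derivative (\<lambda>d. u0 * frechet_derivative f (at z) d
      + (\<Sum>j\<in>UNIV. u $ j * frechet_derivative (\<lambda>z. g z $ j) (at z) d))) (at z)" for z
    unfolding inner_vec_def inner_real_def by (rule derivative_eq_intros F G refl)+ simp
  have "grad_y (\<lambda>z. u0 * f z + u \<bullet> g z) x y \<bullet> d = stat f g u0 u (x, y) \<bullet> d" for d
    unfolding grad_y_inner[OF differentiableI[OF L]] frechet_derivative_at[OF L, symmetric] stat_def
    using grad_y_inner[OF differentiableI[OF F]] grad_y_inner[OF differentiableI[OF G]]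
    by (simp add: inner_add_left inner_sum_left)
  then show ?thesis
    by (metis vector_eq_rdot)
qed

text \<open>Translates the matrix form of the second order conditions into the derivative that
  occurs in the relations between constraint gradients.\<close>

lemma hess_lagr_mult:
  fixes f :: "real \<times> (real^'m) \<Rightarrow> real" and g :: "real \<times> (real^'m) \<Rightarrow> real^'p"
  assumes f: "Ck_on 2 UNIV f" and g: "Ck_on 2 UNIV g"
  shows "hess_lagr f g x y u *v d = Dstat f g 1 u (x, y) (0, d)"
  unfolding hess_lagr_def
  using grad_y_lin_comb[OF assms, of 1] has_derivative_stat(1)[OF assms]
  by (intro hess_yy_mult) auto

subsection \<open>Linear independence for the programs CP and CPFJ\<close>

text \<open>A combination of gradients is zero iff its inner product with every direction is zero.
  Hence derivatives suffice and no gradient has to be computed; the sum over active constraints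
  splits into the three index families.\<close>

lemma mpcc_licqI:
  fixes P :: "('z::euclidean_space, 'e::finite, 'i::finite, 'k::finite) mpcc"
  assumes feas: "mpcc_feasible P z"
    and E: "\<And>e. (equ P e has_derivative E e) (at z)"
    and I: "\<And>i. (ineq P i has_derivative I i) (at z)"
    and S: "\<And>k. (sgn_var P k has_derivative S k) (at z)"
    and indep: "\<And>v w s. (\<And>d. (\<Sum>e\<in>UNIV. v e * E e d) + (\<Sum>i | ineq P i z = 0. w i * I i d)
          + (\<Sum>k | sgn_var P k z = 0. s k * S k d) = 0) \<Longrightarrow>
        (\<forall>e. v e = 0) \<and> (\<forall>i. ineq P i z = 0 \<longrightarrow> w i = 0) \<and> (\<forall>k. sgn_var P k z = 0 \<longrightarrow> s k = 0)"
  shows "mpcc_licq P z"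
proof -
  have "indep_family (mpcc_grad P z) (mpcc_active P z)"
  proof (subst indep_family_iff)
    show fin: "finite (mpcc_active P z)"
      by (simp add: mpcc_active_def)
    show "\<forall>c. (\<Sum>a\<in>mpcc_active P z. c a *\<^sub>R mpcc_grad P z a) = 0 \<longrightarrow> (\<forall>a\<in>mpcc_active P z. c a = 0)"
    proof (intro allI impI)
      fix c :: "'e + 'i + 'k \<Rightarrow> real"
      assume c: "(\<Sum>a\<in>mpcc_active P z. c a *\<^sub>R mpcc_grad P z a) = 0"
      have "(\<Sum>e\<in>UNIV. c (Inl e) * E e d) + (\<Sum>i | ineq P i z = 0. c (Inr (Inl i)) * I i d)
          + (\<Sum>k | sgn_var P k z = 0. c (Inr (Inr k)) * S k d) = 0" for d
      proof -
        have "(\<Sum>a\<in>mpcc_active P z. c a * (mpcc_grad P z a \<bullet> d))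
            = (\<Sum>e\<in>UNIV. c (Inl e) * (grad (equ P e) z \<bullet> d))
              + (\<Sum>i | ineq P i z = 0. c (Inr (Inl i)) * (grad (ineq P i) z \<bullet> d))
              + (\<Sum>k | sgn_var P k z = 0. c (Inr (Inr k)) * (grad (sgn_var P k) z \<bullet> d))"
          unfolding mpcc_active_def
          by (subst sum.union_disjoint, (auto)[3])+
            (simp add: sum.reindex inj_on_def mpcc_grad_def)
        moreover have "(\<Sum>a\<in>mpcc_active P z. c a * (mpcc_grad P z a \<bullet> d)) = 0"
          using arg_cong[OF c, of "\<lambda>w. w \<bullet> d"] by (simp add: inner_sum_left)
        ultimately show ?thesis
          by (simp add: grad_inner[OF E] grad_inner[OF I] grad_inner[OF S])
      qed
      from indep[OF this] show "\<forall>a\<in>mpcc_active P z. c a = 0"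
        by (auto simp: mpcc_active_def)
    qed
  qed
  with feas show ?thesis
    by (simp add: mpcc_licq_def)
qed

lemma has_derivative_component:
  fixes g :: "real \<times> (real^'m) \<Rightarrow> real^'p"
  assumes "Ck_on 2 UNIV g"
  shows "((\<lambda>z. g z $ j) has_derivative (\<lambda>d. frechet_derivative g (at z) d $ j)) (at z)"
  using Ck_on_2_differentiable(1)[OF assms]
  by (intro bounded_linear.has_derivative[OF bounded_linear_vec_nth])
    (simp add: frechet_derivative_works[symmetric])

lemma dgy_inner:
  assumes "Ck_on 2 UNIV g"
  shows "dgy g x y j \<bullet> d = frechet_derivative g (at (x, y)) (0, d) $ j"
  using grad_y_inner[OF differentiableI[OF has_derivative_component[OF assms]]]
    frechet_derivative_at[OF has_derivative_component[OF assms], of "(x, y)" j]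
  by metis

lemma frechet_derivative_zero: "h differentiable at z \<Longrightarrow> frechet_derivative h (at z) 0 = 0"
  using linear_0 linear_frechet_derivative by blast

lemma stat_axis: "stat f g 0 (axis k 1) (x, y) = dgy g x y k"
proof -
  have "stat f g 0 (axis k 1) (x, y) = (\<Sum>j\<in>UNIV. if j = k then dgy g x y j else 0)"
    unfolding stat_def by (simp add: axis_def if_distrib[of "\<lambda>r. r *\<^sub>R _"] eq_commute cong: if_cong)
  then show ?thesis
    by simp
qed

text \<open>Directions in \<open>(x, y)\<close> give the first premise of \<open>indep\<close>. The
  direction of \<open>u $ k\<close> gives orthogonality to \<open>v\<close> if \<open>u $ k\<close>
  is nonzero, and otherwise expresses the weight of the sign constraint through \<open>v\<close>.
  Only \<open>v\<close> and \<open>w\<close> remain to be treated.\<close>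

lemma CP_licqI:
  fixes f :: "real \<times> (real^'m) \<Rightarrow> real" and g :: "real \<times> (real^'m) \<Rightarrow> real^'p"
  assumes f: "Ck_on 2 UNIV f" and g: "Ck_on 2 UNIV g"
    and y: "y \<in> feas g x" and kkt: "kkt_multiplier f g x y u"
    and indep: "\<And>v w. (\<And>dz. v \<bullet> Dstat f g 1 u (x, y) dz
          + (\<Sum>j\<in>active g x y. w j * frechet_derivative g (at (x, y)) dz $ j) = 0) \<Longrightarrow>
        (\<And>j. u $ j \<noteq> 0 \<Longrightarrow> dgy g x y j \<bullet> v = 0) \<Longrightarrow> v = 0 \<and> (\<forall>j\<in>active g x y. w j = 0)"
  shows "mpcc_licq (CP F f g \<mu>) (x, y, u)"
proof (rule mpcc_licqI)
  let ?D = "Dstat f g 1 u (x, y)" and ?G = "frechet_derivative g (at (x, y))"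
  have "grad_y f x y + (\<Sum>j\<in>UNIV. (u $ j) *\<^sub>R dgy g x y j) = 0"
    using kkt by (simp add: kkt_multiplier_def)
  then have "equ (CP F f g \<mu>) i (x, y, u) = 0" for i
    by (simp add: CP_def del: vector_add_component sum_component)
  then show "mpcc_feasible (CP F f g \<mu>) (x, y, u)"
    using y kkt by (auto simp: mpcc_feasible_def CP_def feas_def kkt_multiplier_def less_eq_vec_def)
  show "(equ (CP F f g \<mu>) i has_derivative
      (\<lambda>(dx, dy, du). (?D (dx, dy) + stat f g 0 du (x, y)) $ i)) (at (x, y, u))" for i
  proof -
    \<comment> \<open>The variables of \<open>CP\<close> are embedded into those of
      \<open>stat\<close> with \<open>u0\<close> frozen at 1, so its increment is 0.\<close>
    have "((\<lambda>(x, y, u). ((x, y), 1 :: real, u)) has_derivative (\<lambda>(dx, dy, du). ((dx, dy), 0, du)))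
        (at (x, y, u))"
      by (auto simp: case_prod_beta' intro!: derivative_eq_intros)
    from has_derivative_compose[OF this, unfolded prod.case, OF has_derivative_stat(2)[OF f g]]
    have "((\<lambda>(x, y, u). stat f g 1 u (x, y)) has_derivative
        (\<lambda>(dx, dy, du). ?D (dx, dy) + stat f g 0 du (x, y))) (at (x, y, u))"
      by (simp add: case_prod_beta')
    from bounded_linear.has_derivative[OF bounded_linear_vec_nth this, of i] show ?thesis
      by (simp add: CP_def stat_def case_prod_beta')
  qed
  show "(ineq (CP F f g \<mu>) j has_derivative (\<lambda>(dx, dy, du). ?G (dx, dy) $ j)) (at (x, y, u))" for j
  proof -
    have "((\<lambda>(x, y, u). (x, y)) has_derivative (\<lambda>(dx, dy, du). (dx, dy))) (at (x, y, u))"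
      by (auto simp: case_prod_beta' intro!: derivative_eq_intros)
    from has_derivative_compose[OF this, unfolded prod.case, OF has_derivative_component[OF g]]
    show ?thesis
      by (simp add: CP_def case_prod_beta')
  qed
  show "(sgn_var (CP F f g \<mu>) k has_derivative (\<lambda>(dx, dy, du). du $ k)) (at (x, y, u))" for k
    unfolding CP_def
    by (auto simp: case_prod_beta' intro!: derivative_eq_intros
        bounded_linear.has_derivative[OF bounded_linear_vec_nth])
  fix v :: "'m \<Rightarrow> real" and w s :: "'p \<Rightarrow> real"
  assume sum0: "\<And>d. (\<Sum>i\<in>UNIV. v i * (case d of (dx, dy, du) \<Rightarrow> (?D (dx, dy) + stat f g 0 du (x, y)) $ i))
      + (\<Sum>j | ineq (CP F f g \<mu>) j (x, y, u) = 0. w j * (case d of (dx, dy, du) \<Rightarrow> ?G (dx, dy) $ j))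
      + (\<Sum>k | sgn_var (CP F f g \<mu>) k (x, y, u) = 0. s k * (case d of (dx, dy, du) \<Rightarrow> du $ k)) = 0"
  define V where "V = (\<chi> i. v i)"
  have key: "V \<bullet> (?D dz + stat f g 0 du (x, y)) + (\<Sum>j\<in>active g x y. w j * ?G dz $ j)
      + (\<Sum>k | u $ k = 0. s k * du $ k) = 0" for dz du
    using sum0[of "(fst dz, snd dz, du)"]
    by (simp add: V_def inner_vec_def CP_def active_def)
  have dz: "V \<bullet> ?D dz + (\<Sum>j\<in>active g x y. w j * ?G dz $ j) = 0" for dz
    using key[of dz 0] by (simp add: stat_def)
  have D0: "?D 0 = 0"
    by (intro frechet_derivative_zero differentiableI[OF has_derivative_stat(1)[OF f g]])
  \<comment> \<open>Test with the k-th unit direction of the multiplier space.\<close>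
  have du: "V \<bullet> dgy g x y k + (if u $ k = 0 then s k else 0) = 0" for k
  proof -
    have "(\<Sum>i | u $ i = 0. s i * axis k 1 $ i) = (\<Sum>i | u $ i = 0. if i = k then s i else 0)"
      by (intro sum.cong) (auto simp: axis_def)
    then have "(\<Sum>i | u $ i = 0. s i * axis k 1 $ i) = (if u $ k = 0 then s k else 0)"
      by (simp add: sum.delta)
    then show ?thesis
      using key[of 0 "axis k 1"] Ck_on_2_differentiable(1)[OF g]
      by (simp add: stat_axis frechet_derivative_zero D0)
  qed
  have "dgy g x y j \<bullet> V = 0" if "u $ j \<noteq> 0" for j
    using du[of j] that by (simp add: inner_commute)
  from indep[OF dz this] have VW: "V = 0" "\<forall>j\<in>active g x y. w j = 0"
    by blast+
  moreover have "s k = 0" if "u $ k = 0" for k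
    using du[of k] that VW(1) by simp
  moreover have "v i = 0" for i
    using VW(1) by (simp add: V_def vec_eq_iff)
  ultimately show "(\<forall>i. v i = 0) \<and> (\<forall>j. ineq (CP F f g \<mu>) j (x, y, u) = 0 \<longrightarrow> w j = 0)
      \<and> (\<forall>k. sgn_var (CP F f g \<mu>) k (x, y, u) = 0 \<longrightarrow> s k = 0)"
    by (simp add: CP_def active_def)
qed

text \<open>As for \<open>CP\<close>, but the weight \<open>t\<close> of the normalization enters
  every multiplier direction with coefficient 1, and the constraint on \<open>u0\<close> is active
  because \<open>u0 = 0\<close>.\<close>

lemma CPFJ_licqI:
  fixes f :: "real \<times> (real^'m) \<Rightarrow> real" and g :: "real \<times> (real^'m) \<Rightarrow> real^'p"
  assumes f: "Ck_on 2 UNIV f" and g: "Ck_on 2 UNIV g"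
    and y: "y \<in> feas g x" and fj: "fj_multiplier f g x y 0 u"
    and indep: "\<And>v w t. (\<And>dz. v \<bullet> Dstat f g 0 u (x, y) dz
          + (\<Sum>j\<in>active g x y. w j * frechet_derivative g (at (x, y)) dz $ j) = 0) \<Longrightarrow>
        (\<And>j. u $ j \<noteq> 0 \<Longrightarrow> dgy g x y j \<bullet> v + t = 0) \<Longrightarrow>
        v = 0 \<and> t = 0 \<and> (\<forall>j\<in>active g x y. w j = 0)"
  shows "mpcc_licq (CPFJ F f g \<mu>) (x, y, 0, u)"
proof (rule mpcc_licqI)
  let ?D = "Dstat f g 0 u (x, y)" and ?G = "frechet_derivative g (at (x, y))"
  let ?E = "\<lambda>c (dx, dy, du0, du). case c of None \<Rightarrow> du0 + (\<Sum>j\<in>UNIV. du $ j)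
      | Some i \<Rightarrow> (?D (dx, dy) + stat f g du0 du (x, y)) $ i"
  let ?S = "\<lambda>c (dx, dy, du0, du). case c of None \<Rightarrow> du0 | Some k \<Rightarrow> du $ k"
  have "(\<Sum>j\<in>UNIV. (u $ j) *\<^sub>R dgy g x y j) = 0"
    using fj by (simp add: fj_multiplier_def)
  moreover have u: "0 \<le> u $ j" for j
    using fj by (simp add: fj_multiplier_def less_eq_vec_def)
  moreover have "(\<Sum>j\<in>UNIV. u $ j) = 1"
    using fj u by (simp add: fj_multiplier_def)
  ultimately have "equ (CPFJ F f g \<mu>) c (x, y, 0, u) = 0" for c
    by (cases c) (simp_all add: CPFJ_def del: vector_add_component sum_component)
  then show "mpcc_feasible (CPFJ F f g \<mu>) (x, y, 0, u)"
    using y fj u by (auto simp: mpcc_feasible_def CPFJ_def feas_def fj_multiplier_def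
        less_eq_vec_def split: option.split)
  show "(equ (CPFJ F f g \<mu>) c has_derivative ?E c) (at (x, y, 0, u))" for c
  proof (cases c)
    case None
    then show ?thesis
      unfolding CPFJ_def
      by (auto simp: case_prod_beta' intro!: derivative_eq_intros
          bounded_linear.has_derivative[OF bounded_linear_vec_nth])
  next
    case (Some i)
    have "((\<lambda>(x, y, u0 :: real, u). ((x, y), u0, u)) has_derivative
        (\<lambda>(dx, dy, du0, du). ((dx, dy), du0, du))) (at (x, y, 0, u))"
      by (auto simp: case_prod_beta' intro!: derivative_eq_intros)
    from has_derivative_compose[OF this, unfolded prod.case, OF has_derivative_stat(2)[OF f g]]
    have "((\<lambda>(x, y, u0, u). stat f g u0 u (x, y)) has_derivative
        (\<lambda>(dx, dy, du0, du). ?D (dx, dy) + stat f g du0 du (x, y))) (at (x, y, 0, u))"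
      by (simp add: case_prod_beta')
    from bounded_linear.has_derivative[OF bounded_linear_vec_nth this, of i] Some show ?thesis
      by (simp add: CPFJ_def stat_def case_prod_beta')
  qed
  show "(ineq (CPFJ F f g \<mu>) j has_derivative (\<lambda>(dx, dy, du0, du). ?G (dx, dy) $ j))
      (at (x, y, 0, u))" for j
  proof -
    have "((\<lambda>(x, y, u0 :: real, u). (x, y)) has_derivative (\<lambda>(dx, dy, du0, du). (dx, dy)))
        (at (x, y, 0, u))"
      by (auto simp: case_prod_beta' intro!: derivative_eq_intros)
    from has_derivative_compose[OF this, unfolded prod.case, OF has_derivative_component[OF g]]
    show ?thesis
      by (simp add: CPFJ_def case_prod_beta')
  qed
  show "(sgn_var (CPFJ F f g \<mu>) c has_derivative ?S c) (at (x, y, 0, u))" for c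
    unfolding CPFJ_def
    by (cases c) (auto simp: case_prod_beta' intro!: derivative_eq_intros
        bounded_linear.has_derivative[OF bounded_linear_vec_nth])
  fix v :: "'m option \<Rightarrow> real" and w :: "'p \<Rightarrow> real" and s :: "'p option \<Rightarrow> real"
  assume sum0: "\<And>d. (\<Sum>c\<in>UNIV. v c * ?E c d)
      + (\<Sum>j | ineq (CPFJ F f g \<mu>) j (x, y, 0, u) = 0.
          w j * (case d of (dx, dy, du0, du) \<Rightarrow> ?G (dx, dy) $ j))
      + (\<Sum>c | sgn_var (CPFJ F f g \<mu>) c (x, y, 0, u) = 0. s c * ?S c d) = 0"
  define V where "V = (\<chi> i. v (Some i))"
  have sgn: "{c. sgn_var (CPFJ F f g \<mu>) c (x, y, 0, u) = 0} = insert None (Some ` {k. u $ k = 0})"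
  proof (rule Set.set_eqI)
    fix c :: "'p option"
    show "c \<in> {c. sgn_var (CPFJ F f g \<mu>) c (x, y, 0, u) = 0}
        \<longleftrightarrow> c \<in> insert None (Some ` {k. u $ k = 0})"
      by (cases c) (auto simp: CPFJ_def)
  qed
  have key: "v None * (du0 + (\<Sum>j\<in>UNIV. du $ j)) + V \<bullet> (?D dz + stat f g du0 du (x, y))
      + (\<Sum>j\<in>active g x y. w j * ?G dz $ j)
      + (s None * du0 + (\<Sum>k | u $ k = 0. s (Some k) * du $ k)) = 0" for dz du0 du
    using sum0[of "(fst dz, snd dz, du0, du)"]
    unfolding sgn UNIV_option_conv
    by (simp add: V_def inner_vec_def CPFJ_def active_def sum.reindex)
  have dz: "V \<bullet> ?D dz + (\<Sum>j\<in>active g x y. w j * ?G dz $ j) = 0" for dz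
    using key[of 0 0 dz] by (simp add: stat_def)
  have D0: "?D 0 = 0"
    by (intro frechet_derivative_zero differentiableI[OF has_derivative_stat(1)[OF f g]])
  have du: "V \<bullet> dgy g x y k + v None + (if u $ k = 0 then s (Some k) else 0) = 0" for k
  proof -
    have "(\<Sum>i | u $ i = 0. s (Some i) * axis k 1 $ i)
        = (\<Sum>i | u $ i = 0. if i = k then s (Some i) else 0)"
      by (intro sum.cong) (auto simp: axis_def)
    then have "(\<Sum>i | u $ i = 0. s (Some i) * axis k 1 $ i) = (if u $ k = 0 then s (Some k) else 0)"
      by (simp add: sum.delta)
    moreover have "(\<Sum>j\<in>UNIV. axis k (1::real) $ j) = 1"
      by (simp add: axis_def)
    ultimately show ?thesis
      using key[of 0 "axis k 1" 0] Ck_on_2_differentiable(1)[OF g]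
      by (simp add: stat_axis frechet_derivative_zero D0)
  qed
  have "dgy g x y j \<bullet> V + v None = 0" if "u $ j \<noteq> 0" for j
    using du[of j] that by (simp add: inner_commute)
  from indep[OF dz this] have VW: "V = 0" "v None = 0" "\<forall>j\<in>active g x y. w j = 0"
    by blast+
  \<comment> \<open>Once \<open>V\<close> and the normalization weight vanish, the direction
    \<open>du0 = 1\<close> sees only the weight of the sign constraint on \<open>u0\<close>.\<close>
  have "s None = 0"
    using VW key[of 1 0 0] Ck_on_2_differentiable(1)[OF g]
    by (simp add: frechet_derivative_zero D0)
  moreover have "s (Some k) = 0" if "u $ k = 0" for k
    using du[of k] VW(1,2) that by simp
  moreover have "v c = 0" for c
    using VW(1,2) by (cases c) (simp_all add: V_def vec_eq_iff)
  ultimately show "(\<forall>c. v c = 0) \<and> (\<forall>j. ineq (CPFJ F f g \<mu>) j (x, y, 0, u) = 0 \<longrightarrow> w j = 0)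
      \<and> (\<forall>c. sgn_var (CPFJ F f g \<mu>) c (x, y, 0, u) = 0 \<longrightarrow> s c = 0)"
    using VW(3) by (simp add: CPFJ_def active_def split: option.split)
qed

subsection \<open>The types of generalized critical points\<close>

text \<open>All products \<open>u $ i * g (x, y) $ i\<close> are nonpositive and sum to 0, so each
  is 0.\<close>

lemma complementary_support:
  fixes g :: "real \<times> (real^'m) \<Rightarrow> real^'p"
  assumes y: "y \<in> feas g x" and u: "0 \<le> u" "u \<bullet> g (x, y) = 0" and j: "u $ j \<noteq> 0"
  shows "j \<in> active g x y"
proof -
  have neg: "0 \<le> - (u $ i * g (x, y) $ i)" for i
    using y u(1) by (simp add: feas_def less_eq_vec_def mult_nonneg_nonpos)
  have "(\<Sum>i\<in>UNIV. - (u $ i * g (x, y) $ i)) = 0"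
    using u(2) by (simp add: inner_vec_def sum_negf)
  then have "u $ j * g (x, y) $ j = 0"
    using neg by (subst (asm) sum_nonneg_eq_0_iff) auto
  with j show ?thesis
    by (simp add: active_def)
qed

lemma sum_active:
  fixes a :: "'p::finite \<Rightarrow> 'a::real_vector"
  assumes "{j. u $ j \<noteq> 0} \<subseteq> J"
  shows "(\<Sum>j\<in>UNIV. (u $ j) *\<^sub>R a j) = (\<Sum>j\<in>J. (u $ j) *\<^sub>R a j)"
  by (rule sum.mono_neutral_right) (use assms in auto)

lemma kkt_multiplier_crit_multiplier:
  assumes "y \<in> feas g x" and "kkt_multiplier f g x y u"
  shows "crit_multiplier f g x y u"
proof -
  have supp: "{j. u $ j \<noteq> 0} \<subseteq> active g x y"
    using assms complementary_support unfolding kkt_multiplier_def by blast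
  from sum_active[OF this, where a = "dgy g x y"] assms(2) supp show ?thesis
    unfolding crit_multiplier_def kkt_multiplier_def by auto
qed

text \<open>Serves to identify the multiplier hidden in the existential quantifiers of Types 1 and 2
  with a given KKT multiplier.\<close>

lemma crit_multiplier_unique:
  assumes "licq g x y" "crit_multiplier f g x y u" "crit_multiplier f g x y u'"
  shows "u = u'"
proof -
  have "grad_y f x y + (\<Sum>j\<in>active g x y. (u $ j) *\<^sub>R dgy g x y j)
      = grad_y f x y + (\<Sum>j\<in>active g x y. (u' $ j) *\<^sub>R dgy g x y j)"
    using assms(2,3) by (simp add: crit_multiplier_def)
  then have "(\<Sum>j\<in>active g x y. (u $ j) *\<^sub>R dgy g x y j)
      = (\<Sum>j\<in>active g x y. (u' $ j) *\<^sub>R dgy g x y j)"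
    by (rule add_left_imp_eq)
  from indep_family_coeff_unique[OF _ _ this] assms(1) have "u $ j = u' $ j" if "j \<in> active g x y" for j
    using that by (simp add: licq_def)
  moreover have "u $ j = u' $ j" if "j \<notin> active g x y" for j
    using assms(2,3) that by (simp add: crit_multiplier_def)
  ultimately show ?thesis
    by (metis vec_eq_iff)
qed

lemma tangent_sum_zero:
  assumes "d \<in> tangent g x y J"
  shows "(\<Sum>j\<in>J. w j * (dgy g x y j \<bullet> d)) = 0"
  using assms by (intro sum.neutral) (simp add: tangent_def)

lemma sum_dgy_eq_zero:
  fixes g :: "real \<times> (real^'m) \<Rightarrow> real^'p"
  assumes g: "Ck_on 2 UNIV g"
    and "\<And>dz. (\<Sum>j\<in>J. w j * frechet_derivative g (at (x, y)) dz $ j) = 0"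
  shows "(\<Sum>j\<in>J. w j *\<^sub>R dgy g x y j) = 0"
proof -
  have "(\<Sum>j\<in>J. w j *\<^sub>R dgy g x y j) \<bullet> d = 0" for d
    using assms(2)[of "(0, d)"] by (simp add: inner_sum_left dgy_inner[OF g])
  then show ?thesis
    by (rule inner_eq_zero_iff[THEN iffD1])
qed

text \<open>Common end of Types 1 and 2. In directions \<open>(0, d)\<close> with \<open>d\<close>
  tangent to \<open>J\<close> the terms with \<open>w\<close> drop out, so \<open>v\<close>, itself
  tangent to \<open>J\<close>, is annihilated by the reduced Hessian. What then remains is a
  relation among the active y-gradients.\<close>

lemma licq_nonsingular_indep:
  fixes f :: "real \<times> (real^'m) \<Rightarrow> real" and g :: "real \<times> (real^'m) \<Rightarrow> real^'p"
  assumes f: "Ck_on 2 UNIV f" and g: "Ck_on 2 UNIV g"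
    and licq: "licq g x y" and J: "J \<subseteq> active g x y" "\<forall>j\<in>active g x y - J. w j = 0"
    and nons: "nonsingular_on (hess_lagr f g x y u) (tangent g x y J)"
    and dz: "\<And>dz. v \<bullet> Dstat f g 1 u (x, y) dz
          + (\<Sum>j\<in>active g x y. w j * frechet_derivative g (at (x, y)) dz $ j) = 0"
    and v: "\<And>j. j \<in> J \<Longrightarrow> dgy g x y j \<bullet> v = 0"
  shows "v = 0 \<and> (\<forall>j\<in>active g x y. w j = 0)"
proof -
  have wJ: "(\<Sum>j\<in>active g x y. w j * a j) = (\<Sum>j\<in>J. w j * a j)" for a
    by (rule sum.mono_neutral_right) (use J in auto)
  have "v \<bullet> (hess_lagr f g x y u *v d) = 0" if "d \<in> tangent g x y J" for d
    using dz[of "(0, d)"] tangent_sum_zero[OF that, of w]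
    unfolding hess_lagr_mult[OF f g] wJ by (simp add: dgy_inner[OF g])
  then have v0: "v = 0"
    using v by (intro nonsingular_onD[OF nons]) (auto simp: tangent_def)
  have "(\<Sum>j\<in>active g x y. w j *\<^sub>R dgy g x y j) = 0"
    using dz by (intro sum_dgy_eq_zero[OF g]) (simp add: v0)
  with licq v0 show ?thesis
    using indep_familyD[of "active g x y" "dgy g x y" w] by (auto simp: licq_def)
qed

lemma type1_CP_licq:
  fixes f :: "real \<times> (real^'m) \<Rightarrow> real" and g :: "real \<times> (real^'m) \<Rightarrow> real^'p"
  assumes f: "Ck_on 2 UNIV f" and g: "Ck_on 2 UNIV g" and y: "y \<in> feas g x"
    and kkt: "kkt_multiplier f g x y u" and "type1 f g x y"
  shows "mpcc_licq (CP F f g \<mu>) (x, y, u)"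
proof -
  obtain u' where licq: "licq g x y" and u': "crit_multiplier f g x y u'"
    "\<forall>j\<in>active g x y. u' $ j \<noteq> 0"
    "nonsingular_on (hess_lagr f g x y u') (tangent g x y (active g x y))"
    using assms(5) unfolding type1_def by blast
  have "u' = u"
    by (rule crit_multiplier_unique[OF licq u'(1) kkt_multiplier_crit_multiplier[OF y kkt]])
  then have nons: "nonsingular_on (hess_lagr f g x y u) (tangent g x y (active g x y))"
    and nz: "\<And>j. j \<in> active g x y \<Longrightarrow> u $ j \<noteq> 0"
    using u' by simp_all
  show ?thesis
  proof (rule CP_licqI[OF f g y kkt])
    fix v w
    assume dz: "\<And>dz. v \<bullet> Dstat f g 1 u (x, y) dz
          + (\<Sum>j\<in>active g x y. w j * frechet_derivative g (at (x, y)) dz $ j) = 0"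
      and v: "\<And>j. u $ j \<noteq> 0 \<Longrightarrow> dgy g x y j \<bullet> v = 0"
    show "v = 0 \<and> (\<forall>j\<in>active g x y. w j = 0)"
      by (rule licq_nonsingular_indep[OF f g licq order_refl _ nons dz v[OF nz]]) simp_all
  qed
qed

section \<open>Derivatives along a critical branch and Type 2\<close>

lemma has_derivative_locally_zero:
  fixes h :: "'a::real_normed_vector \<Rightarrow> 'b::real_normed_vector"
  assumes h: "(h has_derivative h') (at x)" and e: "0 < e" and z: "\<And>t. t \<in> ball x e \<Longrightarrow> h t = 0"
  shows "h' d = 0"
proof -
  have "((\<lambda>_. 0) has_derivative h') (at x)"
    by (rule has_derivative_transform_within_open[OF h open_ball[of x e] centre_in_ball[THEN iffD2, OF e] z])
  from has_derivative_unique[OF this has_derivative_const] show ?thesis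
    by (rule fun_cong)
qed

lemma deriv_eq_derivative_1:
  fixes h :: "real \<Rightarrow> real"
  assumes "(h has_derivative h') (at x)"
  shows "deriv h x = h' 1"
proof (rule DERIV_imp_deriv, rule has_derivative_imp_has_field_derivative[OF assms])
  show "d * h' 1 = h' d" for d
    using linear_scale[OF has_derivative_linear[OF assms], of d 1] by simp
qed

text \<open>The velocity \<open>(1, Y 1)\<close> of the branch keeps the constraints in
  \<open>J\<close> at zero, changes \<open>g_q\<close> to first order, and moves the stationarity
  map only within the span of the y-gradients in \<open>J\<close>, to which \<open>v\<close> is
  orthogonal. Hence \<open>w q = 0\<close>, and the Hessian condition on the tangent space of
  \<open>J\<close> applies.\<close>

lemma type2_CP_licq:
  fixes f :: "real \<times> (real^'m) \<Rightarrow> real" and g :: "real \<times> (real^'m) \<Rightarrow> real^'p"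
  assumes f: "Ck_on 2 UNIV f" and g: "Ck_on 2 UNIV g" and y: "y \<in> feas g x"
    and kkt: "kkt_multiplier f g x y u" and "type2 f g x y"
  shows "mpcc_licq (CP F f g \<mu>) (x, y, u)"
proof -
  obtain u' q yt ut where licq: "licq g x y" and crit: "crit_multiplier f g x y u'"
    and q: "{j \<in> active g x y. u' $ j = 0} = {q}"
    and nons: "nonsingular_on (hess_lagr f g x y u') (tangent g x y (active g x y - {q}))"
    and branch: "crit_branch f g (active g x y - {q}) x y u' yt ut"
    and crossing: "deriv (\<lambda>t. g (t, yt t) $ q) x \<noteq> 0"
    using assms(5) unfolding type2_def by blast
  have u': "u' = u"
    by (rule crit_multiplier_unique[OF licq crit kkt_multiplier_crit_multiplier[OF y kkt]])
  define J where "J = active g x y - {q}"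
  let ?G = "frechet_derivative g (at (x, y))"
  have nons': "nonsingular_on (hess_lagr f g x y u) (tangent g x y J)"
    using nons by (simp add: u' J_def)
  have J: "active g x y = insert q J" "q \<notin> J" and uJ: "\<And>j. j \<in> J \<Longrightarrow> u $ j \<noteq> 0"
    using q by (auto simp: J_def u')
  have [simp]: "yt x = y" "ut x = u"
    using branch by (auto simp: crit_branch_def u')
  obtain e where e: "0 < e" and yt: "Ck_on 2 (ball x e) yt" and ut: "Ck_on 2 (ball x e) ut"
    and sys: "\<And>t. t \<in> ball x e \<Longrightarrow>
        grad_y f t (yt t) + (\<Sum>j\<in>J. (ut t $ j) *\<^sub>R dgy g t (yt t) j) = 0"
      "\<And>t j. t \<in> ball x e \<Longrightarrow> j \<in> J \<Longrightarrow> g (t, yt t) $ j = 0"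
      "\<And>t j. t \<in> ball x e \<Longrightarrow> j \<notin> J \<Longrightarrow> ut t $ j = 0"
    using branch unfolding crit_branch_def J_def by blast
  define Y where "Y = frechet_derivative yt (at x)"
  define U where "U = frechet_derivative ut (at x)"
  have Y: "(yt has_derivative Y) (at x)" and U: "(ut has_derivative U) (at x)"
    using yt ut e by (simp_all add: Y_def U_def numeral_2_eq_2 frechet_derivative_works[symmetric])
  have path: "((\<lambda>t. (t, yt t)) has_derivative (\<lambda>d. (d, Y d))) (at x)"
    by (intro derivative_intros Y)
  have gpath: "((\<lambda>t. g (t, yt t) $ j) has_derivative (\<lambda>d. ?G (d, Y d) $ j)) (at x)" for j
    using has_derivative_compose[OF path, of "\<lambda>z. g z $ j"] has_derivative_component[OF g, of j "(x, y)"]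
    by simp
  have GJ: "?G (1, Y 1) $ j = 0" if "j \<in> J" for j
    using has_derivative_locally_zero[OF gpath e] sys(2) that by blast
  have Gq: "?G (1, Y 1) $ q \<noteq> 0"
    using crossing by (simp add: deriv_eq_derivative_1[OF gpath])
  have UJ: "U 1 $ j = 0" if "j \<notin> J" for j
    using has_derivative_locally_zero[OF bounded_linear.has_derivative[OF bounded_linear_vec_nth U] e]
      sys(3) that by blast
  have branch': "((\<lambda>t. ((t, yt t), 1 :: real, ut t)) has_derivative (\<lambda>d. ((d, Y d), 0, U d))) (at x)"
    by (intro derivative_intros path U)
  have "((\<lambda>(z, u0, u). stat f g u0 u z) has_derivative
      (\<lambda>(dz, du0, du). Dstat f g 1 u (x, y) dz + stat f g du0 du (x, y))) (at ((x, yt x), 1, ut x))"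
    using has_derivative_stat(2)[OF f g] by simp
  from has_derivative_compose[OF branch' this]
  have statpath: "((\<lambda>t. stat f g 1 (ut t) (t, yt t)) has_derivative
      (\<lambda>d. Dstat f g 1 u (x, y) (d, Y d) + stat f g 0 (U d) (x, y))) (at x)"
    by simp
  have "stat f g 1 (ut t) (t, yt t) = 0" if "t \<in> ball x e" for t
  proof -
    have "{j. ut t $ j \<noteq> 0} \<subseteq> J"
      using sys(3)[OF that] by blast
    from sum_active[OF this, where a = "dgy g t (yt t)"] sys(1)[OF that] show ?thesis
      by (simp add: stat_def)
  qed
  from has_derivative_locally_zero[OF statpath e this]
  have "Dstat f g 1 u (x, y) (1, Y 1) + stat f g 0 (U 1) (x, y) = 0"
    by blast
  moreover have "{j. U 1 $ j \<noteq> 0} \<subseteq> J"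
    using UJ by blast
  \<comment> \<open>The differentiated stationarity equation: the change in \<open>(x, y)\<close> is
    balanced by that of the multipliers, which are supported in \<open>J\<close>.\<close>
  ultimately have D1: "Dstat f g 1 u (x, y) (1, Y 1) = - (\<Sum>j\<in>J. U 1 $ j *\<^sub>R dgy g x y j)"
    using sum_active[of "U 1" J "dgy g x y"] by (simp add: stat_def eq_neg_iff_add_eq_0)
  show ?thesis
  proof (rule CP_licqI[OF f g y kkt])
    fix v w
    assume dz: "\<And>dz. v \<bullet> Dstat f g 1 u (x, y) dz + (\<Sum>j\<in>active g x y. w j * ?G dz $ j) = 0"
      and v: "\<And>j. u $ j \<noteq> 0 \<Longrightarrow> dgy g x y j \<bullet> v = 0"
    have "v \<bullet> Dstat f g 1 u (x, y) (1, Y 1) = 0"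
      using v uJ by (simp add: D1 inner_sum_right inner_commute)
    \<comment> \<open>Along the branch only the constraint \<open>q\<close> contributes.\<close>
    moreover have "(\<Sum>j\<in>active g x y. w j * ?G (1, Y 1) $ j) = w q * ?G (1, Y 1) $ q"
      using J GJ by simp
    ultimately have "w q = 0"
      using dz[of "(1, Y 1)"] Gq by simp
    with J show "v = 0 \<and> (\<forall>j\<in>active g x y. w j = 0)"
      by (intro licq_nonsingular_indep[OF f g licq _ _ nons' dz v[OF uJ]]) auto
  qed
qed

lemma type5_CP_licq:
  fixes f :: "real \<times> (real^'m) \<Rightarrow> real" and g :: "real \<times> (real^'m) \<Rightarrow> real^'p"
  assumes f: "Ck_on 2 UNIV f" and g: "Ck_on 2 UNIV g" and y: "y \<in> feas g x"
    and kkt: "kkt_multiplier f g x y u" and "type5 f g x y"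
  shows "mpcc_licq (CP F f g \<mu>) (x, y, u)"
proof -
  define J where "J = active g x y"
  have card: "card J = CARD('m) + 1"
    and full: "indep_family (\<lambda>j. grad (\<lambda>z. g z $ j) (x, y)) J"
    and sub: "\<And>K. K \<subseteq> J \<Longrightarrow> card K = CARD('m) \<Longrightarrow> indep_family (dgy g x y) K"
    and mult: "\<And>i. i \<in> J \<Longrightarrow> \<exists>u. grad_y f x y + (\<Sum>j\<in>J - {i}. u j *\<^sub>R dgy g x y j) = 0 \<and>
           (\<forall>j\<in>J - {i}. u j \<noteq> 0)"
    using assms(5) unfolding type5_def J_def Let_def by blast+
  have cardi: "card (J - {i}) = CARD('m)" if "i \<in> J" for i
    using card that by simp
  have crit: "grad_y f x y + (\<Sum>j\<in>J. (u $ j) *\<^sub>R dgy g x y j) = 0"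
    using kkt_multiplier_crit_multiplier[OF y kkt] by (simp add: crit_multiplier_def J_def)
  \<comment> \<open>If \<open>u $ i = 0\<close>, the other components are the unique multipliers
    obtained by omitting \<open>i\<close>, which are nonzero by Type 5. If no component on
    \<open>J\<close> vanishes, any index may be omitted.\<close>
  have "\<exists>i\<in>J. \<forall>j\<in>J - {i}. u $ j \<noteq> 0"
  proof (cases "\<exists>i\<in>J. u $ i = 0")
    case True
    then obtain i where i: "i \<in> J" "u $ i = 0"
      by blast
    obtain u' where u': "grad_y f x y + (\<Sum>j\<in>J - {i}. u' j *\<^sub>R dgy g x y j) = 0"
      "\<forall>j\<in>J - {i}. u' j \<noteq> 0"
      using mult[OF i(1)] by blast
    have "grad_y f x y + (\<Sum>j\<in>J - {i}. (u $ j) *\<^sub>R dgy g x y j) = 0"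
      using crit i by (simp add: sum.remove[of J i])
    with u'(1) have "grad_y f x y + (\<Sum>j\<in>J - {i}. (u $ j) *\<^sub>R dgy g x y j)
        = grad_y f x y + (\<Sum>j\<in>J - {i}. u' j *\<^sub>R dgy g x y j)"
      by simp
    then have "(\<Sum>j\<in>J - {i}. (u $ j) *\<^sub>R dgy g x y j) = (\<Sum>j\<in>J - {i}. u' j *\<^sub>R dgy g x y j)"
      by (rule add_left_imp_eq)
    from indep_family_coeff_unique[OF sub[OF Diff_subset cardi[OF i(1)]] finite this]
    have "u $ j = u' j" if "j \<in> J - {i}" for j
      using that .
    with u'(2) i(1) show ?thesis
      by metis
  next
    case False
    moreover have "J \<noteq> {}"
      using card by auto
    ultimately show ?thesis
      by blast
  qed
  then obtain i where i: "i \<in> J" "\<And>j. j \<in> J - {i} \<Longrightarrow> u $ j \<noteq> 0"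
    by blast
  show ?thesis
  proof (rule CP_licqI[OF f g y kkt])
    fix v w
    assume dz: "\<And>dz. v \<bullet> Dstat f g 1 u (x, y) dz
          + (\<Sum>j\<in>active g x y. w j * frechet_derivative g (at (x, y)) dz $ j) = 0"
      and v: "\<And>j. u $ j \<noteq> 0 \<Longrightarrow> dgy g x y j \<bullet> v = 0"
    \<comment> \<open>\<open>v\<close> is orthogonal to m independent vectors in an m-dimensional
      space.\<close>
    have v0: "v = 0"
      using v i sub[of "J - {i}"] cardi
      by (intro indep_family_full_orthogonal[of "dgy g x y" "J - {i}"]) auto
    have "(\<Sum>j\<in>J. w j *\<^sub>R grad (\<lambda>z. g z $ j) (x, y)) \<bullet> d = 0" for d
      using dz[of d] by (simp add: v0 inner_sum_left grad_inner[OF has_derivative_component[OF g]] J_def)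
    then have "(\<Sum>j\<in>J. w j *\<^sub>R grad (\<lambda>z. g z $ j) (x, y)) = 0"
      by (rule inner_eq_zero_iff[THEN iffD1])
    from indep_familyD[OF _ full this] v0 show "v = 0 \<and> (\<forall>j\<in>active g x y. w j = 0)"
      by (simp add: J_def)
  qed
qed

text \<open>Under KKT the y-gradient of \<open>f\<close> is a combination of active gradients, hence
  orthogonal to the tangent space. Then \<open>b = 0\<close>, against
  \<open>b^T A^-1 b \<noteq> 0\<close>.\<close>

lemma type4_not_kkt:
  fixes f :: "real \<times> (real^'m) \<Rightarrow> real" and g :: "real \<times> (real^'m) \<Rightarrow> real^'p"
  assumes y: "y \<in> feas g x" and "type4 f g x y"
  shows "\<not> kkt_holds f g x y"
proof
  assume "kkt_holds f g x y"
  then obtain u where "kkt_multiplier f g x y u"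
    by (auto simp: kkt_holds_def)
  from kkt_multiplier_crit_multiplier[OF y this]
  have gf: "grad_y f x y = - (\<Sum>j\<in>active g x y. (u $ j) *\<^sub>R dgy g x y j)"
    by (simp add: crit_multiplier_def eq_neg_iff_add_eq_0)
  obtain bs H Ainv where bs: "basis_list bs (tangent g x y (active g x y))"
    and inv: "inverts_mat Ainv (reduced_mat bs H)"
    and b: "scalar_prod (reduced_vec bs (grad_y f x y)) (Ainv *\<^sub>v reduced_vec bs (grad_y f x y)) \<noteq> 0"
    using assms(2) unfolding type4_def Let_def by blast
  \<comment> \<open>\<open>scalar_prod\<close> sums over the dimension of its second argument, here
    \<open>dim_row Ainv\<close>; entries of \<open>b\<close> are known only below
    \<open>length bs\<close>.\<close>
  have "dim_row Ainv = length bs"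
    using arg_cong[OF inv[unfolded inverts_mat_def], of dim_col] by (simp add: reduced_mat_def)
  moreover have "bs ! i \<bullet> grad_y f x y = 0" if "i < length bs" for i
  proof -
    have "bs ! i \<in> span (set bs)"
      using that by (simp add: span_base)
    then have "bs ! i \<in> tangent g x y (active g x y)"
      using bs by (simp add: basis_list_def)
    then show ?thesis
      by (simp add: gf inner_sum_right tangent_def inner_commute)
  qed
  ultimately show False
    using b by (simp add: scalar_prod_def reduced_vec_def)
qed

lemma type4_CPFJ_licq:
  fixes f :: "real \<times> (real^'m) \<Rightarrow> real" and g :: "real \<times> (real^'m) \<Rightarrow> real^'p"
  assumes f: "Ck_on 2 UNIV f" and g: "Ck_on 2 UNIV g" and y: "y \<in> feas g x"
    and fj: "fj_multiplier f g x y 0 u" and "type4 f g x y"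
  shows "mpcc_licq (CPFJ F f g \<mu>) (x, y, 0, u)"
proof -
  define J where "J = active g x y"
  let ?G = "frechet_derivative g (at (x, y))"
  obtain l bs Ainv where dim: "dim (dgy g x y ` J) = card J - 1"
    and l: "(\<Sum>j\<in>J. l j *\<^sub>R dgy g x y j) = 0" "\<And>j. j \<in> J \<Longrightarrow> l j \<noteq> 0"
    and lx: "(\<Sum>j\<in>J. l j * deriv (\<lambda>t. g (t, y) $ j) x) \<noteq> 0"
    and bs: "basis_list bs (tangent g x y J)"
    and inv: "inverts_mat (reduced_mat bs (hess_yy (\<lambda>z. \<Sum>j\<in>J. l j * g z $ j) x y)) Ainv"
      "inverts_mat Ainv (reduced_mat bs (hess_yy (\<lambda>z. \<Sum>j\<in>J. l j * g z $ j) x y))"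
    using assms(5) unfolding type4_def Let_def J_def by blast
  have u: "0 \<le> u" "u \<bullet> g (x, y) = 0" and usum: "(\<Sum>j\<in>UNIV. \<bar>u $ j\<bar>) = 1"
    and "(\<Sum>j\<in>UNIV. (u $ j) *\<^sub>R dgy g x y j) = 0"
    using fj by (simp_all add: fj_multiplier_def)
  have supp: "{j. u $ j \<noteq> 0} \<subseteq> J"
    using complementary_support[OF y u] unfolding J_def by blast
  have uJ: "(\<Sum>j\<in>J. (u $ j) *\<^sub>R dgy g x y j) = 0"
    using \<open>(\<Sum>j\<in>UNIV. (u $ j) *\<^sub>R dgy g x y j) = 0\<close> sum_active[OF supp, where a = "dgy g x y"] by simp
  obtain c where c: "\<And>j. j \<in> J \<Longrightarrow> u $ j = c * l j"
    using relation_unique_up_to_scaling[OF _ dim l uJ] by auto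
  have "(\<Sum>j\<in>J. u $ j) = 1"
    using usum u(1) supp by (subst sum.mono_neutral_left[of UNIV J]) (auto simp: less_eq_vec_def)
  \<comment> \<open>The components of \<open>u\<close> sum to 1, so \<open>u\<close> is not the zero
    multiple of \<open>l\<close>; thus every active component of \<open>u\<close> is
    nonzero.\<close>
  then have c0: "c \<noteq> 0"
    using c by auto
  \<comment> \<open>\<open>l\<close> extended by zero off the active set, so that the function in
    Type 4 is a Lagrangian with \<open>u0 = 0\<close> and its Hessian is a rescaled
    \<open>Dstat\<close>.\<close>
  define lv :: "real^'p" where "lv = (\<chi> j. if j \<in> J then l j else 0)"
  have u_lv: "u = c *\<^sub>R lv"
    using c supp by (auto simp: vec_eq_iff lv_def)
  have D: "((stat f g 0 lv) has_derivative (\<lambda>d. inverse c *\<^sub>R Dstat f g 0 u (x, y) d)) (at (x, y))"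
  proof -
    have "stat f g 0 lv = (\<lambda>z. inverse c *\<^sub>R stat f g 0 u z)"
      using c0 by (simp add: fun_eq_iff stat_def u_lv scaleR_sum_right mult.assoc[symmetric])
    then show ?thesis
      using has_derivative_scaleR_right[OF has_derivative_stat(1)[OF f g]] by simp
  qed
  have "(\<lambda>z. \<Sum>j\<in>J. l j * g z $ j) = (\<lambda>z. 0 * f z + lv \<bullet> g z)"
    by (simp add: inner_vec_def lv_def fun_eq_iff if_distrib[of "\<lambda>r. r * _"] sum.If_cases
        cong: if_cong)
  then have H: "hess_yy (\<lambda>z. \<Sum>j\<in>J. l j * g z $ j) x y *v d
      = inverse c *\<^sub>R Dstat f g 0 u (x, y) (0, d)" for d
    using grad_y_lin_comb[OF f g, of 0 lv x] hess_yy_mult[OF _ D] by simp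
  show ?thesis
  proof (rule CPFJ_licqI[OF f g y fj])
    fix v w t
    assume dz: "\<And>dz. v \<bullet> Dstat f g 0 u (x, y) dz + (\<Sum>j\<in>active g x y. w j * ?G dz $ j) = 0"
      and v: "\<And>j. u $ j \<noteq> 0 \<Longrightarrow> dgy g x y j \<bullet> v + t = 0"
    have vt: "dgy g x y j \<bullet> v = - t" if "j \<in> J" for j
      using v[of j] c[OF that] l(2)[OF that] c0 by simp
    \<comment> \<open>All active y-gradients have the same inner product \<open>- t\<close> with
      \<open>v\<close>; weighting by \<open>u\<close>, whose components sum to 1, isolates
      \<open>t\<close>.\<close>
    have "0 = (\<Sum>j\<in>J. (u $ j) *\<^sub>R dgy g x y j) \<bullet> v"
      using uJ by simp
    also have "\<dots> = (\<Sum>j\<in>J. u $ j) * (- t)"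
      unfolding inner_sum_left sum_distrib_right by (intro sum.cong) (simp_all add: vt)
    finally have t: "t = 0"
      using \<open>(\<Sum>j\<in>J. u $ j) = 1\<close> by simp
    have "v \<in> tangent g x y J"
      using vt by (simp add: tangent_def t)
    moreover have "v \<bullet> Dstat f g 0 u (x, y) (0, d) = 0" if "d \<in> tangent g x y J" for d
      using dz[of "(0, d)"] tangent_sum_zero[OF that, of w] by (simp add: dgy_inner[OF g] J_def)
    ultimately have v0: "v = 0"
      using reduced_mat_left_kernel[OF bs inv] by (simp add: H)
    have wJ: "(\<Sum>j\<in>J. w j *\<^sub>R dgy g x y j) = 0"
      using dz by (intro sum_dgy_eq_zero[OF g]) (simp add: v0 J_def)
    obtain r where r: "\<And>j. j \<in> J \<Longrightarrow> w j = r * l j"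
      using relation_unique_up_to_scaling[OF finite dim l wJ] by blast
    have dx: "deriv (\<lambda>t. g (t, y) $ j) x = ?G (1, 0) $ j" for j
    proof -
      have "((\<lambda>t. (t, y)) has_derivative (\<lambda>d. (d, 0))) (at x)"
        by (intro derivative_intros)
      then have "((\<lambda>t. g (t, y) $ j) has_derivative (\<lambda>d. ?G (d, 0) $ j)) (at x)"
        by (rule has_derivative_compose[OF _ has_derivative_component[OF g]])
      then show ?thesis
        by (rule deriv_eq_derivative_1)
    qed
    \<comment> \<open>The pure x-direction: here the Type 4 condition on x-derivatives forces
      \<open>r = 0\<close>.\<close>
    have "r * (\<Sum>j\<in>J. l j * ?G (1, 0) $ j) = (\<Sum>j\<in>J. w j * ?G (1, 0) $ j)"
      unfolding sum_distrib_left by (intro sum.cong) (simp_all add: r)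
    also have "\<dots> = 0"
      using dz[of "(1, 0)"] by (simp add: v0 J_def)
    finally have "r = 0"
      using lx by (simp add: dx)
    with v0 t r show "v = 0 \<and> t = 0 \<and> (\<forall>j\<in>active g x y. w j = 0)"
      by (simp add: J_def)
  qed
qed

subsection \<open>Existence and signs of multipliers\<close>

text \<open>Dividing by a positive \<open>u0\<close> would give a KKT multiplier.\<close>

lemma fj_multiplier_abnormal:
  fixes f :: "real \<times> (real^'m) \<Rightarrow> real" and g :: "real \<times> (real^'m) \<Rightarrow> real^'p"
  assumes "\<not> kkt_holds f g x y" and fj: "fj_multiplier f g x y u0 u"
  shows "u0 = 0"
proof (rule ccontr)
  assume "u0 \<noteq> 0"
  then have u0: "0 < u0"
    using fj by (simp add: fj_multiplier_def)
  have "grad_y f x y + (\<Sum>i\<in>UNIV. (inverse u0 *\<^sub>R u) $ i *\<^sub>R dgy g x y i)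
      = inverse u0 *\<^sub>R (u0 *\<^sub>R grad_y f x y + (\<Sum>i\<in>UNIV. (u $ i) *\<^sub>R dgy g x y i))"
    using u0 by (simp add: scaleR_add_right scaleR_sum_right)
  then have "kkt_multiplier f g x y (inverse u0 *\<^sub>R u)"
    using fj u0 by (simp add: fj_multiplier_def kkt_multiplier_def less_eq_vec_def)
  with assms(1) show False
    by (auto simp: kkt_holds_def)
qed

lemma fj_multiplier_abnormal_relation:
  fixes f :: "real \<times> (real^'m) \<Rightarrow> real" and g :: "real \<times> (real^'m) \<Rightarrow> real^'p"
  assumes y: "y \<in> feas g x" and fj: "fj_multiplier f g x y 0 u"
  shows "(\<Sum>j\<in>active g x y. (u $ j) *\<^sub>R dgy g x y j) = 0" and "0 \<le> u $ j"
    and "\<exists>j\<in>active g x y. 0 < u $ j"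
proof -
  have u: "0 \<le> u" "u \<bullet> g (x, y) = 0" and usum: "(\<Sum>j\<in>UNIV. \<bar>u $ j\<bar>) = 1"
    and s: "(\<Sum>j\<in>UNIV. (u $ j) *\<^sub>R dgy g x y j) = 0"
    using fj by (simp_all add: fj_multiplier_def)
  have supp: "{j. u $ j \<noteq> 0} \<subseteq> active g x y"
    using complementary_support[OF y u] by blast
  show "(\<Sum>j\<in>active g x y. (u $ j) *\<^sub>R dgy g x y j) = 0"
    using s sum_active[OF supp, where a = "dgy g x y"] by simp
  show nonneg: "0 \<le> u $ j" for j
    using u(1) by (simp add: less_eq_vec_def)
  obtain k where "u $ k \<noteq> 0"
    using usum by (metis abs_zero sum.neutral zero_neq_one)
  with supp nonneg[of k] show "\<exists>j\<in>active g x y. 0 < u $ j"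
    by force
qed

lemma licq_not_abnormal:
  assumes "y \<in> feas g x" "licq g x y"
  shows "\<not> fj_multiplier f g x y 0 u"
proof
  assume "fj_multiplier f g x y 0 u"
  note rel = fj_multiplier_abnormal_relation[OF assms(1) this]
  from indep_familyD[OF _ _ rel(1)] assms(2) rel(3) show False
    by (force simp: licq_def)
qed

text \<open>The inner product of the positive relation among active gradients with the MFCQ
  direction would be negative.\<close>

lemma mfcq_not_abnormal:
  assumes "y \<in> feas g x" "mfcq g x y"
  shows "\<not> fj_multiplier f g x y 0 u"
proof
  assume "fj_multiplier f g x y 0 u"
  note rel = fj_multiplier_abnormal_relation[OF assms(1) this]
  obtain d where d: "\<And>j. j \<in> active g x y \<Longrightarrow> dgy g x y j \<bullet> d < 0"
    using assms(2) by (auto simp: mfcq_def)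
  obtain k where k: "k \<in> active g x y" "0 < u $ k"
    using rel(3) by blast
  have "0 < (\<Sum>j\<in>active g x y. u $ j * - (dgy g x y j \<bullet> d))"
    by (rule sum_pos2[OF _ k(1)]) (use k d rel(2) in \<open>auto simp: mult_pos_neg mult_nonneg_nonpos less_imp_le\<close>)
  also have "\<dots> = - ((\<Sum>j\<in>active g x y. (u $ j) *\<^sub>R dgy g x y j) \<bullet> d)"
    by (simp add: inner_sum_left sum_negf)
  finally show False
    by (simp add: rel(1))
qed

section \<open>Descent directions and the signs of multipliers\<close>

lemma eventually_decrease:
  assumes "h differentiable at (x, y)" and "grad_y h x y \<bullet> d < 0"
  shows "eventually (\<lambda>t. h (x, y + t *\<^sub>R d) < h (x, y)) (at_right (0::real))"
proof -
  let ?D = "frechet_derivative h (at (x, y))"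
  have h: "(h has_derivative ?D) (at (x, y))"
    using assms(1) by (simp add: frechet_derivative_works[symmetric])
  have line: "((\<lambda>t. (x, y + t *\<^sub>R d)) has_derivative (\<lambda>t. (0, t *\<^sub>R d))) (at 0)"
    by (auto intro!: derivative_eq_intros)
  have "((\<lambda>t. h (x, y + t *\<^sub>R d)) has_derivative (\<lambda>t. ?D (0, t *\<^sub>R d))) (at 0)"
    using has_derivative_compose[OF line, of h ?D] h by simp
  moreover have "?D (0, t *\<^sub>R d) = (grad_y h x y \<bullet> d) * t" for t
    using grad_y_inner[OF assms(1), of "t *\<^sub>R d"] by (simp add: mult.commute)
  ultimately have "((\<lambda>t. h (x, y + t *\<^sub>R d)) has_real_derivative grad_y h x y \<bullet> d) (at 0)"
    by (simp add: has_field_derivative_def)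
  from DERIV_neg_dec_right[OF this assms(2)] obtain e where "0 < e"
    "\<And>t. 0 < t \<Longrightarrow> t < e \<Longrightarrow> h (x, y + t *\<^sub>R d) < h (x, y)"
    by auto
  then show ?thesis
    by (auto simp: eventually_at_right_field)
qed

text \<open>A short step along \<open>d\<close> strictly decreases the active constraints and, by
  continuity, keeps the inactive ones negative; if it also decreased \<open>f\<close>, global
  minimality would fail.\<close>

lemma no_feasible_descent:
  fixes f :: "real \<times> (real^'m) \<Rightarrow> real" and g :: "real \<times> (real^'m) \<Rightarrow> real^'p"
  assumes f: "Ck_on 2 UNIV f" and g: "Ck_on 2 UNIV g" and y: "y \<in> sols f g x"
    and d: "\<And>j. j \<in> active g x y \<Longrightarrow> dgy g x y j \<bullet> d < 0"
  shows "0 \<le> grad_y f x y \<bullet> d"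
proof (rule ccontr)
  assume "\<not> 0 \<le> grad_y f x y \<bullet> d"
  then have "eventually (\<lambda>t. f (x, y + t *\<^sub>R d) < f (x, y)) (at_right (0::real))"
    by (intro eventually_decrease Ck_on_2_differentiable[OF f]) simp
  moreover have "eventually (\<lambda>t. g (x, y + t *\<^sub>R d) $ j \<le> 0) (at_right (0::real))" for j
  proof (cases "j \<in> active g x y")
    case True
    then have "eventually (\<lambda>t. g (x, y + t *\<^sub>R d) $ j < g (x, y) $ j) (at_right (0::real))"
      using d by (intro eventually_decrease Ck_on_2_differentiable[OF Ck_on_component[OF g]])
    then show ?thesis
      by (rule eventually_mono) (use True in \<open>simp add: active_def\<close>)
  next
    case False
    then have neg: "g (x, y) $ j < 0"
      using y by (auto simp: active_def sols_def feas_def less_eq_vec_def order.strict_iff_order)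
    have "isCont (\<lambda>z. g z $ j) (x, y)"
      using has_derivative_continuous[OF has_derivative_component[OF g]] .
    moreover have "((\<lambda>t. (x, y + t *\<^sub>R d)) \<longlongrightarrow> (x, y)) (at_right 0)"
      by (auto intro!: tendsto_eq_intros)
    ultimately have "((\<lambda>t. g (x, y + t *\<^sub>R d) $ j) \<longlongrightarrow> g (x, y) $ j) (at_right 0)"
      by (rule isCont_tendsto_compose)
    from order_tendstoD(2)[OF this neg] show ?thesis
      by (rule eventually_mono) simp
  qed
  then have "eventually (\<lambda>t. \<forall>j. g (x, y + t *\<^sub>R d) $ j \<le> 0) (at_right (0::real))"
    by (simp add: eventually_all_finite)
  ultimately have "eventually (\<lambda>t. f (x, y + t *\<^sub>R d) < f (x, y) \<and> (\<forall>j. g (x, y + t *\<^sub>R d) $ j \<le> 0))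
      (at_right (0::real))"
    by (rule eventually_conj)
  then obtain t where "f (x, y + t *\<^sub>R d) < f (x, y)" "\<forall>j. g (x, y + t *\<^sub>R d) $ j \<le> 0"
    using eventually_happens'[OF trivial_limit_at_right_real] by blast
  with y show False
    by (force simp: sols_def feas_def less_eq_vec_def)
qed

text \<open>For a negative component \<open>u $ q\<close>, LICQ yields a direction that strictly
  decreases all active constraints and also \<open>f\<close>, contradicting minimality.\<close>

lemma licq_minimizer_kkt_multiplier:
  fixes f :: "real \<times> (real^'m) \<Rightarrow> real" and g :: "real \<times> (real^'m) \<Rightarrow> real^'p"
  assumes f: "Ck_on 2 UNIV f" and g: "Ck_on 2 UNIV g" and y: "y \<in> sols f g x"
    and licq: "licq g x y" and crit: "crit_multiplier f g x y u"
  shows "kkt_multiplier f g x y u"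
proof -
  let ?J = "active g x y"
  have supp: "{j. u $ j \<noteq> 0} \<subseteq> ?J"
    using crit unfolding crit_multiplier_def by blast
  have gf: "grad_y f x y = - (\<Sum>j\<in>?J. (u $ j) *\<^sub>R dgy g x y j)"
    using crit by (simp add: crit_multiplier_def eq_neg_iff_add_eq_0)
  have "0 \<le> u $ q" for q
  proof (rule ccontr)
    assume q: "\<not> 0 \<le> u $ q"
    define M where "M = (\<Sum>j\<in>?J. \<bar>u $ j\<bar>)"
    \<comment> \<open>The entry at \<open>q\<close> is negative and contributes \<open>1 + M\<close>
      to the sum of \<open>u $ j * r j\<close>; the entries -1 elsewhere contribute at least
      \<open>- M\<close>, so the sum is positive.\<close>
    define r where "r j = (if j = q then (1 + M) / u $ q else - 1)" for j
    have M: "0 \<le> M"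
      by (simp add: M_def sum_nonneg)
    have qJ: "q \<in> ?J"
      using q supp by force
    have r: "r j < 0" for j
      using q M by (simp add: r_def divide_pos_neg)
    obtain d where d: "\<And>j. j \<in> ?J \<Longrightarrow> dgy g x y j \<bullet> d = r j"
      using indep_family_solve[of "dgy g x y" ?J r] licq by (auto simp: licq_def)
    have "- M \<le> (\<Sum>j\<in>?J - {q}. - (u $ j))"
    proof -
      have "(\<Sum>j\<in>?J - {q}. u $ j) \<le> (\<Sum>j\<in>?J - {q}. \<bar>u $ j\<bar>)"
        by (intro sum_mono) simp
      also have "\<dots> \<le> M"
        unfolding M_def by (intro sum_mono2) auto
      finally show ?thesis
        by (simp add: sum_negf)
    qed
    also have "(\<Sum>j\<in>?J - {q}. - (u $ j)) = (\<Sum>j\<in>?J - {q}. u $ j * r j)"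
      by (intro sum.cong) (auto simp: r_def)
    finally have "0 < (\<Sum>j\<in>?J. u $ j * r j)"
      using q qJ M by (simp add: sum.remove[of _ q] r_def)
    moreover have "grad_y f x y \<bullet> d = - (\<Sum>j\<in>?J. u $ j * r j)"
      by (simp add: gf inner_sum_left d)
    ultimately show False
      using no_feasible_descent[OF f g y, of d] d r by simp
  qed
  moreover have "u \<bullet> g (x, y) = 0"
    unfolding inner_vec_def by (rule sum.neutral) (use supp in \<open>auto simp: active_def\<close>)
  ultimately show ?thesis
    using gf sum_active[OF supp, where a = "dgy g x y"] by (simp add: kkt_multiplier_def less_eq_vec_def)
qed

theorem proposition6p1:
  fixes F f :: "real \<times> (real^'m) \<Rightarrow> real"
    and g :: "real \<times> (real^'m) \<Rightarrow> real^'p"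
    and xbar :: real and ybar :: "real^'m"
  assumes "Ck_on 1 UNIV F" and "Ck_on 3 UNIV f" and "Ck_on 3 UNIV g"
    and "\<forall>xhat c. compact {(x, y). \<bar>x - xhat\<bar> \<le> 1 \<and> f (x, y) \<le> c \<and> g (x, y) \<le> 0}"
    and "simple_at f g xbar ybar"
  shows "(sols f g xbar = {ybar} \<and> kkt_holds f g xbar ybar \<longrightarrow>
           (\<forall>u. kkt_multiplier f g xbar ybar u \<longrightarrow> mpcc_licq (CP F f g 0) (xbar, ybar, u)))
       \<and> (sols f g xbar = {ybar} \<and> \<not> kkt_holds f g xbar ybar \<longrightarrow>
           (\<forall>u0 u. fj_multiplier f g xbar ybar u0 u \<longrightarrow>
              u0 = 0 \<and> mpcc_licq (CPFJ F f g 0) (xbar, ybar, u0, u)))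
       \<and> (\<forall>y2. y2 \<noteq> ybar \<and> sols f g xbar = {ybar, y2} \<longrightarrow>
           (\<exists>!u. kkt_multiplier f g xbar ybar u) \<and>
           (\<forall>u \<mu>. kkt_multiplier f g xbar ybar u \<longrightarrow> mpcc_licq (CP F f g \<mu>) (xbar, ybar, u)))"
proof -
  have f: "Ck_on 2 UNIV f" and g: "Ck_on 2 UNIV g"
    using assms(2,3) by (auto intro: Ck_on_SucD simp del: Ck_on.simps simp: numeral_3_eq_3 numeral_2_eq_2)
  have sol: "ybar \<in> sols f g xbar"
    using assms(5) by (simp add: simple_at_def bilevel_feas_def)
  then have y: "ybar \<in> feas g xbar"
    by (simp add: sols_def)
  \<comment> \<open>Case II would require two distinct minimizers.\<close>
  have case1: "simple_case1 f g xbar ybar" if "sols f g xbar = {ybar}"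
    using assms(5) that unfolding simple_at_def simple_case2_def
    by (metis insert_iff singletonD)
  have case2: "type1 f g xbar ybar" if "y2 \<noteq> ybar" "sols f g xbar = {ybar, y2}" for y2
    using assms(5) that unfolding simple_at_def simple_case1_def simple_case2_def
    by (metis insert_iff singletonD)
  have "mpcc_licq (CP F f g 0) (xbar, ybar, u)"
    if "sols f g xbar = {ybar}" and u: "kkt_multiplier f g xbar ybar u" for u
  proof -
    have "kkt_holds f g xbar ybar"
      using u by (auto simp: kkt_holds_def)
    with case1[OF that(1)] type4_not_kkt[OF y] show ?thesis
      using type1_CP_licq[OF f g y u] type2_CP_licq[OF f g y u] type5_CP_licq[OF f g y u]
      unfolding simple_case1_def type5_1_def type5_2_def by blast
  qed
  moreover have "u0 = 0 \<and> mpcc_licq (CPFJ F f g 0) (xbar, ybar, u0, u)"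
    if "sols f g xbar = {ybar}" and nkkt: "\<not> kkt_holds f g xbar ybar"
      and fj: "fj_multiplier f g xbar ybar u0 u" for u0 u
  proof -
    have u0: "u0 = 0"
      by (rule fj_multiplier_abnormal[OF nkkt fj])
    with fj have fj0: "fj_multiplier f g xbar ybar 0 u"
      by simp
    \<comment> \<open>An FJ multiplier with \<open>u0 = 0\<close> is incompatible with LICQ (Types 1
      and 2) and with MFCQ (Type 5-2), while Type 5-1 includes the KKT condition.\<close>
    have "type4 f g xbar ybar"
      using case1[OF that(1)] nkkt licq_not_abnormal[OF y] mfcq_not_abnormal[OF y] fj0
      unfolding simple_case1_def type1_def type2_def type5_1_def type5_2_def by blast
    from type4_CPFJ_licq[OF f g y fj0 this] u0 show ?thesis
      by simp
  qed
  moreover have "(\<exists>!u. kkt_multiplier f g xbar ybar u) \<and>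
      (\<forall>u \<mu>. kkt_multiplier f g xbar ybar u \<longrightarrow> mpcc_licq (CP F f g \<mu>) (xbar, ybar, u))"
    if "y2 \<noteq> ybar" "sols f g xbar = {ybar, y2}" for y2
  proof -
    note t1 = case2[OF that]
    then obtain u where licq: "licq g xbar ybar" and crit: "crit_multiplier f g xbar ybar u"
      unfolding type1_def by blast
    \<comment> \<open>Existence needs the sign argument at a minimizer, since
      \<open>crit_multiplier\<close> carries no sign condition; LICQ gives uniqueness.\<close>
    have "\<exists>!u. kkt_multiplier f g xbar ybar u"
      using licq_minimizer_kkt_multiplier[OF f g sol licq crit]
        crit_multiplier_unique[OF licq] kkt_multiplier_crit_multiplier[OF y] by blast
    with t1 show ?thesis
      using type1_CP_licq[OF f g y] by blast
  qed
  ultimately show ?thesis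
    by blast
qed

end
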